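(* Let $\sigma$ be an operator mean whose representing function is geometrically convex. Then, for every $A,B\in\mathbb{M}_n^+$, $$\textstyle\det^{1/n}(A\,\sigma\,B)\ge(\det^{1/n}A)\,\sigma\,(\det^{1/n}B),$$ and the reverse inequality holds (for every $A,B\in\mathbb{M}_n^+$) if the representing function of $\sigma$ is geometrically concave.
   Context: $\mathbb{M}_n^+$ is the set of positive semidefinite $n\times n$ complex matrices. An operator mean $\sigma$ (in the Kubo–Ando sense) is given by its representing function $h$, a non-negative operator monotone function on $[0,\infty)$ with $h(1)=1$: for invertible $A,B\in\mathbb{M}_n^+$, $A\,\sigma\,B=A^{1/2}h(A^{-1/2}BA^{-1/2})A^{1/2}$, and for general $A,B\in\mathbb{M}_n^+$, $A\,\sigma\,B=\lim_{\varepsilon\searrow0}(A+\varepsilon I)\,\sigma\,(B+\varepsilon I)$. For scalars $a,b\ge0$, $a\,\sigma\,b$ is the case $n=1$ of this definition. A non-negative function $h$ is geometrically convex if $h(\sqrt{xy})\le\sqrt{h(x)h(y)}$, and geometrically concave if $h(\sqrt{xy})\ge\sqrt{h(x)h(y)}$, for all $x,y$ in its domain. $\det^{1/n}A:=(\det A)^{1/n}$. *)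

theory Defs
  imports "Jordan_Normal_Form.Schur_Decomposition" "Jordan_Normal_Form.Determinant"
begin

(* Operator monotonicity quantifies over all matrix sizes, so matrices are carrier-based. *)

definition hermitian_mat :: "complex mat \<Rightarrow> bool" where
  "hermitian_mat A \<longleftrightarrow> square_mat A \<and> mat_adjoint A = A"

(* The order on complex is that of Complex_Order: 0 \<le> z means that z is real and non-negative. *)
definition psd_mats :: "nat \<Rightarrow> complex mat set" where
  "psd_mats n = {A \<in> carrier_mat n n. hermitian_mat A \<and>
     (\<forall>v \<in> carrier_vec n. 0 \<le> (A *\<^sub>v v) \<bullet>c v)}"

definition unitary_mats :: "nat \<Rightarrow> complex mat set" where
  "unitary_mats n = {U \<in> carrier_mat n n. mat_adjoint U * U = 1\<^sub>m n \<and> U * mat_adjoint U = 1\<^sub>m n}"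

(* Functional calculus f(A) through a spectral decomposition of A; meaningful for hermitian A,
   where the result does not depend on the decomposition. *)
definition mat_fun :: "(real \<Rightarrow> real) \<Rightarrow> complex mat \<Rightarrow> complex mat" where
  "mat_fun f A = (THE B. \<exists>U \<in> unitary_mats (dim_row A). \<exists>d :: nat \<Rightarrow> real.
     A = U * mat_diag (dim_row A) (\<lambda>i. complex_of_real (d i)) * mat_adjoint U \<and>
     B = U * mat_diag (dim_row A) (\<lambda>i. complex_of_real (f (d i))) * mat_adjoint U)"

definition operator_monotone :: "(real \<Rightarrow> real) \<Rightarrow> bool" where
  "operator_monotone h \<longleftrightarrow>
     (\<forall>n. \<forall>A \<in> psd_mats n. \<forall>B \<in> psd_mats n.
        B - A \<in> psd_mats n \<longrightarrow> mat_fun h B - mat_fun h A \<in> psd_mats n)"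

(* Functions on [0,\<infinity>) are rendered as total functions on the reals; their values at negative
   arguments are irrelevant. *)
definition representing_function :: "(real \<Rightarrow> real) \<Rightarrow> bool" where
  "representing_function h \<longleftrightarrow> (\<forall>x\<ge>0. 0 \<le> h x) \<and> operator_monotone h \<and> h 1 = 1"

definition inv_op_mean :: "(real \<Rightarrow> real) \<Rightarrow> complex mat \<Rightarrow> complex mat \<Rightarrow> complex mat" where
  "inv_op_mean h A B =
     (let R = mat_fun sqrt A; S = mat_fun (\<lambda>x. 1 / sqrt x) A
      in R * mat_fun h (S * B * S) * R)"

(* The limit is taken entrywise, which on matrices of a fixed size is convergence in norm. *)
definition op_mean :: "(real \<Rightarrow> real) \<Rightarrow> complex mat \<Rightarrow> complex mat \<Rightarrow> complex mat" where
  "op_mean h A B =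
     (if invertible_mat A \<and> invertible_mat B then inv_op_mean h A B
      else (let n = dim_row A in
        mat n n (\<lambda>ij. Lim (at_right (0 :: real))
          (\<lambda>\<epsilon>. inv_op_mean h (A + complex_of_real \<epsilon> \<cdot>\<^sub>m 1\<^sub>m n) (B + complex_of_real \<epsilon> \<cdot>\<^sub>m 1\<^sub>m n) $$ ij))))"

definition scalar_mean :: "(real \<Rightarrow> real) \<Rightarrow> real \<Rightarrow> real \<Rightarrow> real" where
  "scalar_mean h a b =
     Re (op_mean h (mat 1 1 (\<lambda>_. complex_of_real a)) (mat 1 1 (\<lambda>_. complex_of_real b)) $$ (0, 0))"

(* The determinant of a positive semidefinite matrix is real and non-negative. *)
definition det_root :: "complex mat \<Rightarrow> real" where
  "det_root A = root (dim_row A) (Re (det A))"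

definition geometrically_convex_on :: "real set \<Rightarrow> (real \<Rightarrow> real) \<Rightarrow> bool" where
  "geometrically_convex_on S h \<longleftrightarrow> (\<forall>x\<in>S. \<forall>y\<in>S. h (sqrt (x * y)) \<le> sqrt (h x * h y))"

definition geometrically_concave_on :: "real set \<Rightarrow> (real \<Rightarrow> real) \<Rightarrow> bool" where
  "geometrically_concave_on S h \<longleftrightarrow> (\<forall>x\<in>S. \<forall>y\<in>S. h (sqrt (x * y)) \<ge> sqrt (h x * h y))"

end

theory Submission
  imports Defs "HOL-Computational_Algebra.Fundamental_Theorem_Algebra"
begin

text \<open>
For invertible \<open>A\<close> and \<open>B\<close> the inequality is Jensen's inequality for the eigenvalues
\<open>\<lambda>\<^sub>1, \<dots>, \<lambda>\<^sub>n\<close> of \<open>A^(-1/2) B A^(-1/2)\<close>. Multiplicativity of the determinant gives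
\<open>det (A \<sigma> B) = det A * (\<Prod>i. h \<lambda>\<^sub>i)\<close> and \<open>det B = det A * (\<Prod>i. \<lambda>\<^sub>i)\<close> (\<open>det_inv_op_mean\<close>), while
\<open>a \<sigma> b = a * h (b / a)\<close> for positive scalars. After division by \<open>(det A)^(1/n)\<close> the claim compares
\<open>h\<close> at the geometric mean of the \<open>\<lambda>\<^sub>i\<close> with the geometric mean of the \<open>h \<lambda>\<^sub>i\<close>. In the variable
\<open>ln x\<close>, geometric convexity is midpoint convexity of \<open>ln h\<close>, and with equal weights midpoint convexity
suffices for Jensen's inequality (\<open>geometric_jensen\<close>).

For singular \<open>A\<close> or \<open>B\<close> the mean is a limit of means of \<open>A + \<epsilon> I\<close> and \<open>B + \<epsilon> I\<close>, and the inequality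
passes to the limit once that limit is known to exist and the scalar side is known to converge as well.
Existence follows from monotonicity: \<open>(A + \<epsilon> I) \<sigma> (B + \<epsilon> I)\<close> increases with \<open>\<epsilon>\<close> in the Loewner order
(\<open>inv_op_mean_shift_mono\<close>), so its quadratic form converges, and by polarization so do its entries.
Monotonicity in \<open>B\<close> is operator monotonicity of \<open>h\<close>. Monotonicity in \<open>A\<close> needs Hansen's inequality
\<open>K h(X) K \<le> h(K X K)\<close> for the contraction \<open>K = (A + \<delta> I)^(-1/2) (A + \<epsilon> I)^(1/2)\<close>, where \<open>\<epsilon> \<le> \<delta>\<close>. This \<open>K\<close> is
diagonal in an eigenbasis of \<open>A\<close>, so the diagonal case \<open>hansen_diagonal\<close> is enough; it is proved by
dilating \<open>K\<close> to a unitary of twice the size.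

On the scalar side, the \<open>1 \<times> 1\<close> case of Hansen's inequality shows that \<open>h x / x\<close> is decreasing. Hence
the perspective \<open>x * h (y / x)\<close> is monotone in both positive arguments. It is also homogeneous, and these
two properties force a limit at every boundary point of the quadrant (\<open>perspective_tendsto\<close>).
\<close>

section \<open>Adjoints and unitary matrices\<close>

lemma adjoint_carrier [simp]:
  "A \<in> carrier_mat m n \<Longrightarrow> mat_adjoint A \<in> carrier_mat n m"
  by (auto simp: mat_adjoint_def mat_of_rows_def)

lemma adjoint_dim [simp]:
  "dim_row (mat_adjoint A) = dim_col A" "dim_col (mat_adjoint A) = dim_row A"
  by (auto simp: mat_adjoint_def)

lemma adjoint_index [simp]:
  fixes A :: "complex mat"
  assumes "i < dim_col A" "j < dim_row A"
  shows "mat_adjoint A $$ (i, j) = cnj (A $$ (j, i))"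
  using assms by (simp add: mat_adjoint_def mat_of_rows_def)

lemma adjoint_adjoint [simp]: "mat_adjoint (mat_adjoint A) = (A :: complex mat)"
  by (intro eq_matI) auto

lemma adjoint_mult:
  fixes A B :: "complex mat"
  assumes "A \<in> carrier_mat m n" "B \<in> carrier_mat n k"
  shows "mat_adjoint (A * B) = mat_adjoint B * mat_adjoint A"
  using assms by (intro eq_matI) (auto simp: scalar_prod_def mult.commute intro!: sum.cong)

lemma adjoint_real_diag [simp]:
  "mat_adjoint (mat_diag n (\<lambda>i. complex_of_real (d i))) = mat_diag n (\<lambda>i. complex_of_real (d i))"
  by (intro eq_matI) (auto simp: mat_diag_def)

lemma cinner_adjoint:
  fixes A :: "complex mat"
  assumes A: "A \<in> carrier_mat m n" and v: "v \<in> carrier_vec n" and w: "w \<in> carrier_vec m"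
  shows "(A *\<^sub>v v) \<bullet>c w = v \<bullet>c (mat_adjoint A *\<^sub>v w)"
proof -
  have "(A *\<^sub>v v) \<bullet>c w = (\<Sum>i<m. \<Sum>j<n. A $$ (i,j) * v $ j * cnj (w $ i))"
    using assms by (auto simp: scalar_prod_def sum_distrib_right lessThan_atLeast0 intro!: sum.cong)
  also have "\<dots> = (\<Sum>j<n. \<Sum>i<m. A $$ (i,j) * v $ j * cnj (w $ i))"
    by (rule sum.swap)
  also have "\<dots> = v \<bullet>c (mat_adjoint A *\<^sub>v w)"
    using assms by (auto simp: scalar_prod_def sum_distrib_left lessThan_atLeast0 mult_ac intro!: sum.cong)
  finally show ?thesis .
qed

lemma unitary_matsD:
  assumes "U \<in> unitary_mats n"
  shows "U \<in> carrier_mat n n" "mat_adjoint U * U = 1\<^sub>m n" "U * mat_adjoint U = 1\<^sub>m n"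
  using assms by (auto simp: unitary_mats_def)

lemma unitary_matsI:
  assumes "U \<in> carrier_mat n n" "mat_adjoint U * U = 1\<^sub>m n"
  shows "U \<in> unitary_mats n"
  using assms mat_mult_left_right_inverse[of "mat_adjoint U" n U] by (auto simp: unitary_mats_def)

lemma square_mult_carrier [simp]:
  "A \<in> carrier_mat n n \<Longrightarrow> B \<in> carrier_mat n n \<Longrightarrow> A * B \<in> carrier_mat n n"
  by (rule mult_carrier_mat)

lemma square_mult_assoc:
  "A \<in> carrier_mat n n \<Longrightarrow> B \<in> carrier_mat n n \<Longrightarrow> C \<in> carrier_mat n n \<Longrightarrow>
    A * B * C = A * (B * (C :: complex mat))"
  by (rule assoc_mult_mat)

lemma unitary_mult:
  assumes U: "U \<in> unitary_mats n" and V: "V \<in> unitary_mats n"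
  shows "U * V \<in> unitary_mats n"
proof (rule unitary_matsI)
  note u = unitary_matsD[OF U] and v = unitary_matsD[OF V]
  show "U * V \<in> carrier_mat n n" using u v by auto
  have "mat_adjoint (U * V) * (U * V) = mat_adjoint V * (mat_adjoint U * U) * V"
    using u(1) v(1) by (simp add: adjoint_mult[of U n n V n] square_mult_assoc[of _ n])
  then show "mat_adjoint (U * V) * (U * V) = 1\<^sub>m n" using u v by simp
qed

lemma unitary_adjoint: "U \<in> unitary_mats n \<Longrightarrow> mat_adjoint U \<in> unitary_mats n"
  by (auto simp: unitary_mats_def)

text \<open>Complete \<open>v\<close> to a basis and apply Gram-Schmidt. That procedure yields an orthogonal family starting
with \<open>v\<close>, not an orthonormal one, so the columns still have to be normalised; this is why the first
column is only a multiple of \<open>v\<close>.\<close>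

lemma unitary_first_column:
  fixes v :: "complex vec"
  assumes v: "v \<in> carrier_vec n" and v0: "v \<noteq> 0\<^sub>v n"
  shows "\<exists>W \<in> unitary_mats n. \<exists>c. col W 0 = c \<cdot>\<^sub>v v"
proof -
  interpret cof_vec_space n "TYPE(complex)" .
  define b where "b = basis_completion v"
  from basis_completion[OF v v0, folded b_def]
  have span_b: "span (set b) = carrier_vec n" and dist_b: "distinct b" 
    and indep: "\<not> lin_dep (set b)" and b: "set b \<subseteq> carrier_vec n" and hdb: "hd b = v" 
    and len_b: "length b = n" by auto
  have n: "0 < n"
  proof (rule ccontr)
    assume "\<not> 0 < n"
    then have "v = 0\<^sub>v n" using v by (intro eq_vecI) auto
    with v0 show False by simp
  qed
  from hdb len_b n obtain vs where bv: "b = v # vs" by (cases b, auto)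
  define ws where "ws = gram_schmidt n b"
  from gram_schmidt_result[OF b dist_b indep refl, folded ws_def]
  have ws: "set ws \<subseteq> carrier_vec n" "corthogonal ws" "length ws = n" 
    by (auto simp: len_b)
  from gram_schmidt_hd[OF v, of vs, folded bv] have hdws: "hd ws = v" unfolding ws_def .
  define k where "k w = complex_of_real (1 / sqrt (Re (w \<bullet>c w)))" for w :: "complex vec"
  define W where "W = mat_of_cols n (map (\<lambda>w. k w \<cdot>\<^sub>v w) ws)"
  have W: "W \<in> carrier_mat n n" using ws by (auto simp: W_def)
  have wsi: "ws ! i \<in> carrier_vec n" if "i < n" for i using ws that by auto
  have col: "col W i = k (ws ! i) \<cdot>\<^sub>v ws ! i" if "i < n" for i
    using that ws wsi[OF that] by (simp add: W_def)
  have sp: "col W j \<bullet>c col W i = (if i = j then 1 else 0)" if ij: "i < n" "j < n" for i j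
  proof -
    have e: "col W j \<bullet>c col W i = k (ws ! j) * k (ws ! i) * (ws ! j \<bullet>c ws ! i)"
      using wsi[OF ij(1)] wsi[OF ij(2)] by (simp add: col ij conjugate_smult_vec k_def)
    show ?thesis
    proof (cases "i = j")
      case False
      then show ?thesis using e corthogonalD[OF ws(2), of j i] ij ws by auto
    next
      case True
      let ?q = "ws ! i \<bullet>c ws ! i"
      have "?q \<noteq> 0" using corthogonalD[OF ws(2), of i i] ij ws by auto
      moreover have "0 \<le> ?q" using conjugate_square_ge_0_vec[of "ws ! i"] by simp
      ultimately have "0 < Re ?q" "?q = complex_of_real (Re ?q)"
        by (auto simp: less_eq_complex_def complex_eq_iff intro: order.not_eq_order_implies_strict)
      define r where "r = Re ?q"
      have r: "0 < r" and q: "?q = complex_of_real r"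
        using \<open>0 < Re ?q\<close> \<open>?q = complex_of_real (Re ?q)\<close> by (simp_all add: r_def)
      have "k (ws ! i) = complex_of_real (1 / sqrt r)" by (simp add: k_def r_def)
      then have "k (ws ! i) * k (ws ! i) * ?q = complex_of_real (1 / sqrt r * (1 / sqrt r) * r)"
        by (simp only: q of_real_mult)
      also have "1 / sqrt r * (1 / sqrt r) * r = 1"
        using r by simp
      finally show ?thesis using e True by simp
    qed
  qed
  have "mat_adjoint W * W = 1\<^sub>m n"
  proof (intro eq_matI)
    fix i j assume ij: "i < dim_row (1\<^sub>m n :: complex mat)" "j < dim_col (1\<^sub>m n :: complex mat)"
    have "(mat_adjoint W * W) $$ (i, j) = row (mat_adjoint W) i \<bullet> col W j"
      using ij W by simp
    also have "row (mat_adjoint W) i = conjugate (col W i)"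
      using ij W by (intro eq_vecI) auto
    also have "conjugate (col W i) \<bullet> col W j = col W j \<bullet>c col W i"
      using ij W by (metis conjugate_vec_sprod_comm col_dim carrier_matD(1))
    finally show "(mat_adjoint W * W) $$ (i, j) = 1\<^sub>m n $$ (i, j)"
      using sp ij by auto
  qed (use W in auto)
  then have "W \<in> unitary_mats n" using W by (intro unitary_matsI)
  moreover have "col W 0 = k v \<cdot>\<^sub>v v"
    using col[OF n] hdws ws(3) n by (metis hd_conv_nth length_0_conv less_irrefl)
  ultimately show ?thesis by blast
qed

section \<open>Direct sums and the spectral theorem\<close>

abbreviation real_diag :: "nat \<Rightarrow> (nat \<Rightarrow> real) \<Rightarrow> complex mat" where
  "real_diag n d \<equiv> mat_diag n (\<lambda>i. complex_of_real (d i))"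

definition dsum :: "complex mat \<Rightarrow> complex mat \<Rightarrow> complex mat" where
  "dsum P Q = four_block_mat P (0\<^sub>m (dim_row P) (dim_col Q)) (0\<^sub>m (dim_row Q) (dim_col P)) Q"

lemma dsum_carrier [simp]:
  "P \<in> carrier_mat n m \<Longrightarrow> Q \<in> carrier_mat k l \<Longrightarrow> dsum P Q \<in> carrier_mat (n + k) (m + l)"
  by (auto simp: dsum_def)

lemma dsum_mult:
  assumes "P \<in> carrier_mat n n" "P' \<in> carrier_mat n n" "Q \<in> carrier_mat k k" "Q' \<in> carrier_mat k k"
  shows "dsum P Q * dsum P' Q' = dsum (P * P') (Q * Q')"
  using assms unfolding dsum_def
  by (subst mult_four_block_mat[of _ n n _ k _ k _ _ n _ k])
     (auto simp: left_add_zero_mat[of _ n n] right_add_zero_mat[of _ k k])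

lemma dsum_adjoint: "mat_adjoint (dsum P Q) = dsum (mat_adjoint P) (mat_adjoint Q)"
  by (intro eq_matI) (auto simp: dsum_def)

lemma dsum_one: "dsum (1\<^sub>m n) (1\<^sub>m k) = 1\<^sub>m (n + k)"
  by (intro eq_matI) (auto simp: dsum_def)

lemma dsum_real_diag:
  "dsum (real_diag n d) (real_diag k d') = real_diag (n + k) (\<lambda>i. if i < n then d i else d' (i - n))"
  by (intro eq_matI) (auto simp: dsum_def mat_diag_def)

lemma dsum_unitary:
  assumes "U \<in> unitary_mats n" "V \<in> unitary_mats k"
  shows "dsum U V \<in> unitary_mats (n + k)"
  using unitary_matsD[OF assms(1)] unitary_matsD[OF assms(2)]
  by (intro unitary_matsI) (auto simp: dsum_adjoint dsum_mult[of _ n _ _ k] dsum_one)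

lemma real_diag_carrier: "real_diag n d \<in> carrier_mat n n"
  by simp

lemma conj_unitary_cancel:
  assumes W: "W \<in> unitary_mats n" and A: "A \<in> carrier_mat n n"
  shows "W * (mat_adjoint W * A * W) * mat_adjoint W = A"
proof -
  note w = unitary_matsD[OF W]
  have "W * (mat_adjoint W * A * W) * mat_adjoint W = (W * mat_adjoint W) * A * (W * mat_adjoint W)"
    using w(1) A by (simp add: square_mult_assoc[of _ n])
  then show ?thesis using w A by simp
qed

text \<open>Deflation: a unitary whose first column is an eigenvector of \<open>A\<close> turns that column of \<open>A\<close> into
a multiple of the first unit vector. As \<open>A\<close> is Hermitian its first row vanishes off the diagonal
too, and the remaining block is Hermitian of smaller size.\<close>

theorem spectral_theorem:
  assumes "A \<in> carrier_mat n n" "mat_adjoint A = A"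
  shows "\<exists>U \<in> unitary_mats n. \<exists>d. A = U * real_diag n d * mat_adjoint U"
  using assms
proof (induction n arbitrary: A)
  case 0
  have "1\<^sub>m 0 \<in> unitary_mats 0" by (intro unitary_matsI) auto
  moreover have "A = 1\<^sub>m 0 * real_diag 0 (\<lambda>_. 0) * mat_adjoint (1\<^sub>m 0)"
    using 0 by (intro eq_matI) auto
  ultimately show ?case by (intro bexI exI)
next
  case (Suc n)
  let ?N = "Suc n"
  note A = Suc.prems(1)
  have "degree (char_poly A) = ?N" using degree_monic_char_poly[OF A] by simp
  then have "\<not> constant (poly (char_poly A))" by (simp add: constant_degree)
  then obtain e where "poly (char_poly A) e = 0"
    using fundamental_theorem_of_algebra by blast
  then have "eigenvalue A e" using eigenvalue_root_char_poly[OF A] by simp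
  then obtain v where v: "v \<in> carrier_vec ?N" "v \<noteq> 0\<^sub>v ?N" "A *\<^sub>v v = e \<cdot>\<^sub>v v"
    using A by (auto simp: eigenvalue_def eigenvector_def)
  obtain W c where W: "W \<in> unitary_mats ?N" and c: "col W 0 = c \<cdot>\<^sub>v v"
    using unitary_first_column[OF v(1,2)] by blast
  note w = unitary_matsD[OF W]
  define A' where "A' = mat_adjoint W * A * W"
  have A'c: "A' \<in> carrier_mat ?N ?N" using w A by (simp add: A'_def)
  have herm: "mat_adjoint A' = A'"
    using w(1) A by (simp add: A'_def adjoint_mult[of _ ?N ?N _ ?N] Suc.prems(2) square_mult_assoc[of _ ?N])
  have cW: "col W 0 \<in> carrier_vec ?N" by (rule col_carrier_vec[OF _ w(1)]) simp
  have "col A' 0 = mat_adjoint W *\<^sub>v (A *\<^sub>v col W 0)"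
    using col_mult2[OF adjoint_carrier[OF w(1)] square_mult_carrier[OF A w(1)], of 0] col_mult2[OF A w(1), of 0]
      square_mult_assoc[OF adjoint_carrier[OF w(1)] A w(1)]
    unfolding A'_def by simp
  also have "A *\<^sub>v col W 0 = e \<cdot>\<^sub>v col W 0"
    using v mult_mat_vec[OF A v(1), of c] by (simp add: c smult_smult_assoc mult.commute)
  also have "mat_adjoint W *\<^sub>v (e \<cdot>\<^sub>v col W 0) = e \<cdot>\<^sub>v col (mat_adjoint W * W) 0"
    using mult_mat_vec[OF adjoint_carrier[OF w(1)] cW, of e] col_mult2[of "mat_adjoint W" ?N ?N W ?N 0] w(1)
    by simp
  finally have col0: "col A' 0 = e \<cdot>\<^sub>v unit_vec ?N 0" by (simp add: w(2))
  have ci: "A' $$ (i, 0) = (if i = 0 then e else 0)" if "i < ?N" for i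
    using arg_cong[OF col0, of "\<lambda>v. v $ i"] that A'c by auto
  have sym: "A' $$ (j, i) = cnj (A' $$ (i, j))" if "i < ?N" "j < ?N" for i j
    using arg_cong[OF herm, of "\<lambda>M. M $$ (j, i)"] that A'c by auto
  have e: "complex_of_real (Re e) = e"
    using sym[of 0 0] ci[of 0] by (simp add: complex_eq_iff)
  define A3 where "A3 = mat n n (\<lambda>(i, j). A' $$ (Suc i, Suc j))"
  have A3: "A3 \<in> carrier_mat n n" "mat_adjoint A3 = A3"
    using sym[symmetric] by (auto simp: A3_def intro!: eq_matI)
  obtain U d where U: "U \<in> unitary_mats n" and d: "A3 = U * real_diag n d * mat_adjoint U"
    using Suc.IH[OF A3] by blast
  note u = unitary_matsD[OF U]
  have blk: "A' = dsum (real_diag 1 (\<lambda>_. Re e)) A3"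
  proof (intro eq_matI)
    fix i j assume ij: "i < dim_row (dsum (real_diag 1 (\<lambda>_. Re e)) A3)"
      "j < dim_col (dsum (real_diag 1 (\<lambda>_. Re e)) A3)"
    then have "i < ?N" "j < ?N" by (auto simp: dsum_def A3_def mat_diag_def)
    then show "A' $$ (i, j) = dsum (real_diag 1 (\<lambda>_. Re e)) A3 $$ (i, j)"
      using ci[of i] ci[of j] sym[of j i] sym[of j 0] e
      by (cases i; cases j) (auto simp: dsum_def A3_def mat_diag_def)
  qed (use A'c in \<open>auto simp: dsum_def A3_def mat_diag_def\<close>)
  define V where "V = dsum (1\<^sub>m 1) U"
  define d' where "d' i = (if i < 1 then Re e else d (i - 1))" for i
  have one: "1\<^sub>m 1 \<in> unitary_mats 1" by (intro unitary_matsI) (auto intro: eq_matI)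
  have V: "V \<in> unitary_mats ?N"
    using dsum_unitary[OF one U] by (simp add: V_def)
  note vv = unitary_matsD[OF V]
  have adj1: "mat_adjoint (1\<^sub>m 1) = (1\<^sub>m 1 :: complex mat)" by (intro eq_matI) auto
  have "V * real_diag ?N d' * mat_adjoint V =
      dsum (1\<^sub>m 1) U * dsum (real_diag 1 (\<lambda>_. Re e)) (real_diag n d) * dsum (1\<^sub>m 1) (mat_adjoint U)"
    unfolding dsum_real_diag V_def d'_def dsum_adjoint adj1 by simp
  also have "\<dots> = A'"
    using u(1) by (simp add: blk d dsum_mult[of _ 1 _ _ n] left_mult_one_mat[of _ "Suc 0" "Suc 0"] right_mult_one_mat[of _ "Suc 0" "Suc 0"])
  finally have A': "A' = V * real_diag ?N d' * mat_adjoint V" ..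
  have "A = W * A' * mat_adjoint W"
    using conj_unitary_cancel[OF W A] by (simp add: A'_def)
  also have "\<dots> = (W * V) * real_diag ?N d' * mat_adjoint (W * V)"
    using w(1) vv(1) by (simp add: A' adjoint_mult[of _ ?N ?N _ ?N] square_mult_assoc[of _ ?N])
  finally show ?case using unitary_mult[OF W V] by blast
qed

text \<open>The unitary \<open>W = V\<^sup>* U\<close> intertwines the two diagonal matrices. Entrywise, \<open>W\<^sub>i\<^sub>j d\<^sub>j = d'\<^sub>i W\<^sub>i\<^sub>j\<close>, so
\<open>W\<close> can be nonzero only where the two eigenvalues coincide; hence it also intertwines their images
under \<open>f\<close>.\<close>

lemma spectral_functions_agree:
  assumes U: "U \<in> unitary_mats n" and V: "V \<in> unitary_mats n"
    and eq: "U * real_diag n d * mat_adjoint U = V * real_diag n d' * mat_adjoint V"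
  shows "U * real_diag n (\<lambda>i. f (d i)) * mat_adjoint U = V * real_diag n (\<lambda>i. f (d' i)) * mat_adjoint V"
proof -
  note u = unitary_matsD[OF U] and v = unitary_matsD[OF V]
  define W where "W = mat_adjoint V * U"
  have W: "W \<in> unitary_mats n" using unitary_mult[OF unitary_adjoint[OF V] U] by (simp add: W_def)
  note w = unitary_matsD[OF W]
  have VW: "V * W = U"
  proof -
    have "V * W = (V * mat_adjoint V) * U" using u(1) v(1) by (simp add: W_def square_mult_assoc[of _ n])
    then show ?thesis using u v by simp
  qed
  have "W * real_diag n d = mat_adjoint V * (U * real_diag n d * (mat_adjoint U * U))"
    using u v by (simp add: W_def square_mult_assoc[of _ n] right_mult_one_mat[of _ n n])
  also have "\<dots> = mat_adjoint V * (U * real_diag n d * mat_adjoint U) * U"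
    using u(1) v(1) by (simp add: square_mult_assoc[of _ n])
  also have "\<dots> = (mat_adjoint V * V) * real_diag n d' * (mat_adjoint V * U)"
    unfolding eq using u(1) v(1) by (simp add: square_mult_assoc[of _ n])
  also have "\<dots> = real_diag n d' * W"
    using v u(1) by (simp add: W_def left_mult_one_mat[of _ n n])
  finally have comm: "W * real_diag n d = real_diag n d' * W" .
  have ent: "W $$ (i, j) * d j = d' i * W $$ (i, j)" if "i < n" "j < n" for i j
    using arg_cong[OF comm, of "\<lambda>M. M $$ (i, j)"] that w(1)
    by (simp add: mat_diag_mult_left[of _ n n] mat_diag_mult_right[of _ n n])
  have comm_f: "W * real_diag n (\<lambda>i. f (d i)) = real_diag n (\<lambda>i. f (d' i)) * W"
  proof (intro eq_matI)
    fix i j assume "i < dim_row (real_diag n (\<lambda>i. f (d' i)) * W)" "j < dim_col (real_diag n (\<lambda>i. f (d' i)) * W)"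
    then have ij: "i < n" "j < n" using w(1) by (auto simp: mat_diag_def)
    have "W $$ (i, j) = 0 \<or> d j = d' i"
      using ent[OF ij] by (auto simp: mult.commute)
    then show "(W * real_diag n (\<lambda>i. f (d i))) $$ (i, j) = (real_diag n (\<lambda>i. f (d' i)) * W) $$ (i, j)"
      using ij w(1) by (auto simp: mat_diag_mult_left[of _ n n] mat_diag_mult_right[of _ n n])
  qed (use w(1) in \<open>auto simp: mat_diag_def\<close>)
  have "U * real_diag n (\<lambda>i. f (d i)) * mat_adjoint U = V * (W * real_diag n (\<lambda>i. f (d i))) * mat_adjoint (V * W)"
    using v(1) w(1) by (simp add: VW[symmetric] square_mult_assoc[of _ n])
  also have "\<dots> = V * real_diag n (\<lambda>i. f (d' i)) * (W * mat_adjoint W) * mat_adjoint V"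
    unfolding comm_f using v(1) w(1) by (simp add: adjoint_mult[of _ n n _ n] square_mult_assoc[of _ n])
  finally show ?thesis using v w by (simp add: right_mult_one_mat[of _ n n])
qed

lemma mat_fun_spectral:
  assumes U: "U \<in> unitary_mats n" and A: "A = U * real_diag n d * mat_adjoint U"
  shows "mat_fun f A = U * real_diag n (\<lambda>i. f (d i)) * mat_adjoint U"
proof -
  have n: "dim_row A = n" using A unitary_matsD[OF U] by simp
  show ?thesis
    unfolding mat_fun_def n
  proof (rule the_equality)
    fix B assume "\<exists>V\<in>unitary_mats n. \<exists>d'. A = V * real_diag n d' * mat_adjoint V \<and>
      B = V * real_diag n (\<lambda>i. f (d' i)) * mat_adjoint V"
    then show "B = U * real_diag n (\<lambda>i. f (d i)) * mat_adjoint U"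
      using spectral_functions_agree[OF U] A by metis
  qed (use U A in blast)
qed

section \<open>Quadratic forms and the Loewner order\<close>

text \<open>On Hermitian matrices the inner product is real. Taking its real part keeps all comparisons in the
Loewner order within the linearly ordered reals.\<close>

definition qform :: "complex mat \<Rightarrow> complex vec \<Rightarrow> real" where
  "qform A v = Re ((A *\<^sub>v v) \<bullet>c v)"

lemma cnj_cinner:
  "v \<in> carrier_vec n \<Longrightarrow> w \<in> carrier_vec n \<Longrightarrow> cnj (v \<bullet>c w) = w \<bullet>c (v :: complex vec)"
  by (simp add: scalar_prod_def mult.commute)

lemma psd_iff_qform:
  "A \<in> psd_mats n \<longleftrightarrow> A \<in> carrier_mat n n \<and> mat_adjoint A = A \<and> (\<forall>v \<in> carrier_vec n. 0 \<le> qform A v)"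
proof -
  have "Im ((A *\<^sub>v v) \<bullet>c v) = 0" if "A \<in> carrier_mat n n" "mat_adjoint A = A" "v \<in> carrier_vec n" for v
  proof -
    have "(A *\<^sub>v v) \<bullet>c v = cnj ((A *\<^sub>v v) \<bullet>c v)"
      using that cinner_adjoint[of A n n v v] cnj_cinner[of "A *\<^sub>v v" n v] by simp
    then show ?thesis by (simp add: complex_eq_iff)
  qed
  then show ?thesis
    by (auto simp: psd_mats_def hermitian_mat_def qform_def less_eq_complex_def)
qed

lemma psdD:
  assumes "A \<in> psd_mats n"
  shows "A \<in> carrier_mat n n" "mat_adjoint A = A" "v \<in> carrier_vec n \<Longrightarrow> 0 \<le> qform A v"
  using assms by (auto simp: psd_iff_qform)

lemma qform_congruence:
  assumes "B \<in> carrier_mat n n" "S \<in> carrier_mat n m" "v \<in> carrier_vec m"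
  shows "qform (mat_adjoint S * B * S) v = qform B (S *\<^sub>v v)"
proof -
  have "(mat_adjoint S * B * S) *\<^sub>v v = mat_adjoint S *\<^sub>v (B *\<^sub>v (S *\<^sub>v v))"
    using assms mult_carrier_mat[of "mat_adjoint S" m n B n]
    by (simp add: assoc_mult_mat_vec[of _ m n _ m] assoc_mult_mat_vec[of _ m n _ n])
  then show ?thesis
    using assms cinner_adjoint[of "mat_adjoint S" m n "B *\<^sub>v (S *\<^sub>v v)" v] by (simp add: qform_def)
qed

lemma psd_congruence:
  assumes "B \<in> psd_mats n" "S \<in> carrier_mat n m"
  shows "mat_adjoint S * B * S \<in> psd_mats m"
proof -
  note b = psdD[OF assms(1)]
  have "mat_adjoint (mat_adjoint S * B * S) = mat_adjoint S * B * S"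
    using assms(2) b(1,2) mult_carrier_mat[of "mat_adjoint S" m n B n]
    by (simp add: adjoint_mult[of _ m n _ m] adjoint_mult[of _ m n _ n] adjoint_mult[of _ n n _ m] assoc_mult_mat[of _ m n _ n _ m])
  then show ?thesis
    using assms(2) b(1,3) by (auto simp: psd_iff_qform qform_congruence)
qed

lemma qform_diff:
  assumes "A \<in> carrier_mat n n" "B \<in> carrier_mat n n" "v \<in> carrier_vec n"
  shows "qform (B - A) v = qform B v - qform A v"
  using assms by (simp add: qform_def minus_mult_distrib_mat_vec[of _ n n] minus_scalar_prod_distrib[of _ n])

lemma qform_add:
  assumes "A \<in> carrier_mat n n" "B \<in> carrier_mat n n" "v \<in> carrier_vec n"
  shows "qform (A + B) v = qform A v + qform B v"
  using assms by (simp add: qform_def add_mult_distrib_mat_vec[of _ n n] add_scalar_prod_distrib[of _ n])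

lemma qform_smult:
  assumes "A \<in> carrier_mat n n" "v \<in> carrier_vec n"
  shows "qform (complex_of_real c \<cdot>\<^sub>m A) v = c * qform A v"
proof -
  have "(complex_of_real c \<cdot>\<^sub>m A) *\<^sub>v v = complex_of_real c \<cdot>\<^sub>v (A *\<^sub>v v)"
    using assms by (intro eq_vecI) auto
  then show ?thesis using assms by (simp add: qform_def)
qed

lemma adjoint_minus:
  "A \<in> carrier_mat n m \<Longrightarrow> B \<in> carrier_mat n m \<Longrightarrow> mat_adjoint (B - A) = mat_adjoint B - (mat_adjoint A :: complex mat)"
  by (intro eq_matI) auto

lemma psd_diff_iff:
  assumes "A \<in> carrier_mat n n" "mat_adjoint A = A" "B \<in> carrier_mat n n" "mat_adjoint B = B"
  shows "B - A \<in> psd_mats n \<longleftrightarrow> (\<forall>v \<in> carrier_vec n. qform A v \<le> qform B v)"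
  using assms by (auto simp: psd_iff_qform qform_diff[of _ n] adjoint_minus[of _ n n])

lemma qform_real_diag:
  assumes "v \<in> carrier_vec n"
  shows "qform (real_diag n d) v = (\<Sum>i<n. d i * (cmod (v $ i))\<^sup>2)"
proof -
  have "real_diag n d *\<^sub>v v = vec n (\<lambda>i. complex_of_real (d i) * v $ i)"
    using assms
    by (intro eq_vecI) (auto simp: mat_diag_def scalar_prod_def sum.delta if_distrib[of "\<lambda>x. x * _"] cong: if_cong)
  then have "qform (real_diag n d) v = Re (\<Sum>i<n. complex_of_real (d i) * v $ i * cnj (v $ i))"
    using assms by (simp add: qform_def scalar_prod_def lessThan_atLeast0)
  also have "\<dots> = (\<Sum>i<n. d i * (cmod (v $ i))\<^sup>2)"
    by (auto simp: mult.assoc complex_norm_square[symmetric] intro!: sum.cong)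
  finally show ?thesis .
qed

lemma psd_spectralI:
  assumes U: "U \<in> unitary_mats n" and d: "\<And>i. i < n \<Longrightarrow> 0 \<le> d i"
  shows "U * real_diag n d * mat_adjoint U \<in> psd_mats n"
proof -
  have "real_diag n d \<in> psd_mats n"
    using d by (auto simp: psd_iff_qform qform_real_diag intro!: sum_nonneg)
  from psd_congruence[OF this, of "mat_adjoint U" n] show ?thesis
    using unitary_matsD[OF U] by simp
qed

lemma psd_spectralD:
  assumes A: "U * real_diag n d * mat_adjoint U \<in> psd_mats n" and U: "U \<in> unitary_mats n" and i: "i < n"
  shows "0 \<le> d i"
proof -
  note u = unitary_matsD[OF U]
  have "mat_adjoint U * (U * real_diag n d * mat_adjoint U) * U = real_diag n d"
    using conj_unitary_cancel[OF unitary_adjoint[OF U], of "real_diag n d"] by simp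
  then have "real_diag n d \<in> psd_mats n" using psd_congruence[OF A u(1)] by simp
  then have "0 \<le> qform (real_diag n d) (unit_vec n i)" by (auto simp: psd_iff_qform)
  also have "\<dots> = (\<Sum>j<n. if j = i then d i else 0)"
    using i unfolding qform_real_diag[OF unit_vec_carrier] by (intro sum.cong) auto
  also have "\<dots> = d i" using i by simp
  finally show ?thesis .
qed

lemma psd_spectral:
  assumes "A \<in> psd_mats n"
  obtains U d where "U \<in> unitary_mats n" "A = U * real_diag n d * mat_adjoint U" "\<And>i. i < n \<Longrightarrow> 0 \<le> d i"
  using spectral_theorem[OF psdD(1,2)[OF assms]] psd_spectralD assms by metis

section \<open>Hansen's inequality\<close>

lemma conjugate_append:
  "conjugate (v @\<^sub>v w) = conjugate v @\<^sub>v conjugate (w :: complex vec)"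
  by (intro eq_vecI) auto

lemma qform_dsum:
  assumes P: "P \<in> carrier_mat n n" and Q: "Q \<in> carrier_mat k k" and v: "v \<in> carrier_vec n" and w: "w \<in> carrier_vec k"
  shows "qform (dsum P Q) (v @\<^sub>v w) = qform P v + qform Q w"
proof -
  have "dsum P Q *\<^sub>v (v @\<^sub>v w) = (P *\<^sub>v v) @\<^sub>v (Q *\<^sub>v w)"
    using mult_mat_vec_split[OF P Q v w] P Q by (simp add: dsum_def)
  then show ?thesis
    using assms by (simp add: qform_def conjugate_append scalar_prod_append[of _ n _ k])
qed

lemma dsum_psd:
  assumes P: "P \<in> psd_mats n" and Q: "Q \<in> psd_mats k"
  shows "dsum P Q \<in> psd_mats (n + k)"
  using psdD[OF P] psdD[OF Q] unfolding psd_iff_qform all_vec_append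
  by (auto simp: dsum_adjoint qform_dsum[of _ n _ k])

lemma mat_fun_psd:
  assumes A: "A \<in> psd_mats n" and f: "\<And>x. 0 \<le> x \<Longrightarrow> 0 \<le> f x"
  shows "mat_fun f A \<in> psd_mats n"
  using psd_spectral[OF A] mat_fun_spectral[of _ n A _ f] psd_spectralI f by metis

lemma unitary_conj_spectral:
  assumes U: "U \<in> unitary_mats n" and V: "V \<in> unitary_mats n"
  shows "U * (V * real_diag n d * mat_adjoint V) * mat_adjoint U = (U * V) * real_diag n d * mat_adjoint (U * V)"
  using unitary_matsD(1)[OF U] unitary_matsD(1)[OF V]
  by (simp add: adjoint_mult[of _ n n _ n] square_mult_assoc[of _ n])

lemma mat_fun_unitary_conj:
  assumes U: "U \<in> unitary_mats n" and A: "A \<in> psd_mats n"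
  shows "mat_fun f (U * A * mat_adjoint U) = U * mat_fun f A * mat_adjoint U"
proof -
  obtain V d where V: "V \<in> unitary_mats n" and d: "A = V * real_diag n d * mat_adjoint V"
    using psd_spectral[OF A] by metis
  show ?thesis
    unfolding mat_fun_spectral[OF V d] unitary_conj_spectral[OF U V]
    by (rule mat_fun_spectral[OF unitary_mult[OF U V]]) (simp add: d unitary_conj_spectral[OF U V])
qed

lemma mat_fun_dsum:
  assumes P: "P \<in> psd_mats n" and Q: "Q \<in> psd_mats k"
  shows "mat_fun f (dsum P Q) = dsum (mat_fun f P) (mat_fun f Q)"
proof -
  obtain U d where U: "U \<in> unitary_mats n" and d: "P = U * real_diag n d * mat_adjoint U"
    using psd_spectral[OF P] by metis
  obtain V e where V: "V \<in> unitary_mats k" and e: "Q = V * real_diag k e * mat_adjoint V"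
    using psd_spectral[OF Q] by metis
  have *: "dsum (U * real_diag n d * mat_adjoint U) (V * real_diag k e * mat_adjoint V) =
     dsum U V * real_diag (n + k) (\<lambda>i. if i < n then d i else e (i - n)) * mat_adjoint (dsum U V)" for d e
    unfolding dsum_real_diag[symmetric] dsum_adjoint
    using unitary_matsD(1)[OF U] unitary_matsD(1)[OF V]
    by (simp add: dsum_mult[of _ n _ _ k])
  have "mat_fun f (dsum P Q) =
      dsum U V * real_diag (n + k) (\<lambda>i. f (if i < n then d i else e (i - n))) * mat_adjoint (dsum U V)"
    by (rule mat_fun_spectral[OF dsum_unitary[OF U V]]) (simp only: d e *)
  then show ?thesis
    unfolding mat_fun_spectral[OF U d] mat_fun_spectral[OF V e] * if_distrib[of f] .
qed

lemma qform_scale: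
  assumes "A \<in> carrier_mat n n" "v \<in> carrier_vec n"
  shows "qform A (complex_of_real r \<cdot>\<^sub>v v) = r\<^sup>2 * qform A v"
proof -
  have "A *\<^sub>v (complex_of_real r \<cdot>\<^sub>v v) = complex_of_real r \<cdot>\<^sub>v (A *\<^sub>v v)"
    using assms by (rule mult_mat_vec)
  then show ?thesis
    using assms by (simp add: qform_def conjugate_smult_vec power2_eq_square)
qed

lemma qform_expand:
  assumes A: "A \<in> carrier_mat n n" and v: "v \<in> carrier_vec n" and w: "w \<in> carrier_vec n"
  shows "qform A (v + w) = qform A v + qform A w + Re ((A *\<^sub>v v) \<bullet>c w + (A *\<^sub>v w) \<bullet>c v)"
proof -
  have "A *\<^sub>v (v + w) = A *\<^sub>v v + A *\<^sub>v w" using assms by (rule mult_add_distrib_mat_vec)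
  then show ?thesis
    using assms
    by (simp add: qform_def conjugate_add_vec[of _ n] add_scalar_prod_distrib[of _ n] scalar_prod_add_distrib[of _ n])
qed

text \<open>Young's inequality for the semi-inner product given by \<open>A\<close>: expand the nonnegative value of the
form at \<open>v - w / t\<close> to bound the cross terms. It is used to dominate a \<open>2 \<times> 2\<close> block matrix by a
block diagonal one.\<close>

lemma qform_young:
  assumes A: "A \<in> psd_mats n" and v: "v \<in> carrier_vec n" and w: "w \<in> carrier_vec n" and t: "0 < t"
  shows "qform A (v + w) \<le> (1 + t) * qform A v + (1 + 1 / t) * qform A w"
proof -
  note a = psdD[OF A]
  define s where "s = - 1 / t"
  define r where "r = Re ((A *\<^sub>v v) \<bullet>c w + (A *\<^sub>v w) \<bullet>c v)"
  let ?w = "complex_of_real s \<cdot>\<^sub>v w"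
  have "0 \<le> qform A (v + ?w)" using v w by (intro a(3)) auto
  also have "\<dots> = qform A v + s\<^sup>2 * qform A w + Re ((A *\<^sub>v v) \<bullet>c ?w + (A *\<^sub>v ?w) \<bullet>c v)"
    using qform_expand[OF a(1) v, of ?w] qform_scale[OF a(1) w, of s] w by simp
  also have "(A *\<^sub>v v) \<bullet>c ?w + (A *\<^sub>v ?w) \<bullet>c v = complex_of_real s * ((A *\<^sub>v v) \<bullet>c w + (A *\<^sub>v w) \<bullet>c v)"
    using a(1) v w mult_mat_vec[OF a(1) w, of "complex_of_real s"]
    by (simp add: conjugate_smult_vec algebra_simps)
  finally have "0 \<le> qform A v + s\<^sup>2 * qform A w + s * r" by (simp add: r_def)
  then have "0 \<le> t * (qform A v + s\<^sup>2 * qform A w + s * r)" using t by simp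
  also have "\<dots> = t * qform A v + 1 / t * qform A w - r"
    using t by (simp add: s_def field_simps power2_eq_square)
  finally show ?thesis
    using qform_expand[OF a(1) v w] by (simp add: r_def algebra_simps)
qed

lemma real_diag_mult_vec:
  "v \<in> carrier_vec n \<Longrightarrow> real_diag n d *\<^sub>v v = vec n (\<lambda>i. complex_of_real (d i) * v $ i)"
  by (intro eq_vecI) (auto simp: mat_diag_def scalar_prod_def sum.delta if_distrib[of "\<lambda>x. x * _"] cong: if_cong)

lemma real_diag_mult_vec_carrier [simp]: "v \<in> carrier_vec n \<Longrightarrow> real_diag n d *\<^sub>v v \<in> carrier_vec n"
  by (simp add: real_diag_mult_vec)

lemma qform_scale_real_diag:
  assumes "A \<in> carrier_mat n n" "v \<in> carrier_vec n"
  shows "qform A (real_diag n (\<lambda>i. r * d i) *\<^sub>v v) = r\<^sup>2 * qform A (real_diag n d *\<^sub>v v)"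
proof -
  have "real_diag n (\<lambda>i. r * d i) *\<^sub>v v = complex_of_real r \<cdot>\<^sub>v (real_diag n d *\<^sub>v v)"
    unfolding real_diag_mult_vec[OF assms(2)] by (intro eq_vecI) auto
  then show ?thesis using assms by (simp add: qform_scale[of _ n])
qed

lemma real_diag_psd_congruence:
  "A \<in> psd_mats n \<Longrightarrow> real_diag n d * A * real_diag n d \<in> psd_mats n"
  using psd_congruence[of A n "real_diag n d" n] by simp

lemma qform_real_diag_congruence:
  "A \<in> carrier_mat n n \<Longrightarrow> v \<in> carrier_vec n \<Longrightarrow>
    qform (real_diag n d * A * real_diag n d) v = qform A (real_diag n d *\<^sub>v v)"
  using qform_congruence[of A n "real_diag n d" n v] by simp

text \<open>The unitary dilation (Halmos) of the diagonal contraction with entries \<open>c\<close>. All blocks are real and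
diagonal, so they commute, and the dilation is self-adjoint and its own inverse.\<close>

definition block_reflection :: "nat \<Rightarrow> (nat \<Rightarrow> real) \<Rightarrow> complex mat" where
  "block_reflection n c = (let s = (\<lambda>i. sqrt (1 - (c i)\<^sup>2)) in
     four_block_mat (real_diag n c) (real_diag n s) (real_diag n s) (real_diag n (\<lambda>i. - c i)))"

lemma block_reflection_carrier: "block_reflection n c \<in> carrier_mat (n + n) (n + n)"
  by (simp add: block_reflection_def Let_def)

lemma block_reflection_adjoint: "mat_adjoint (block_reflection n c) = block_reflection n c"
  by (intro eq_matI) (auto simp: block_reflection_def Let_def mat_diag_def)

lemma block_reflection_unitary:
  assumes c: "\<And>i. i < n \<Longrightarrow> 0 \<le> c i \<and> c i \<le> 1"
  shows "block_reflection n c \<in> unitary_mats (n + n)"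
proof -
  define s where "s i = sqrt (1 - (c i)\<^sup>2)" for i
  have cs: "c i * c i + s i * s i = 1" if "i < n" for i
    using c[OF that] by (simp add: s_def power2_eq_square mult_le_one)
  have prod: "real_diag n f * real_diag n g = real_diag n (\<lambda>i. f i * g i)" for f g
    by simp
  have add: "real_diag n f + real_diag n g = real_diag n (\<lambda>i. f i + g i)" for f g
    by (intro eq_matI) (auto simp: mat_diag_def)
  have one: "real_diag n f = 1\<^sub>m n" if "\<And>i. i < n \<Longrightarrow> f i = 1" for f
    using that by (intro eq_matI) (auto simp: mat_diag_def)
  have zero: "real_diag n f = 0\<^sub>m n n" if "\<And>i. i < n \<Longrightarrow> f i = 0" for f
    using that by (intro eq_matI) (auto simp: mat_diag_def)
  have "block_reflection n c * block_reflection n c = four_block_mat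
      (real_diag n c * real_diag n c + real_diag n s * real_diag n s)
      (real_diag n c * real_diag n s + real_diag n s * real_diag n (\<lambda>i. - c i))
      (real_diag n s * real_diag n c + real_diag n (\<lambda>i. - c i) * real_diag n s)
      (real_diag n s * real_diag n s + real_diag n (\<lambda>i. - c i) * real_diag n (\<lambda>i. - c i))"
    unfolding block_reflection_def Let_def s_def[symmetric]
    by (rule mult_four_block_mat[of _ n n _ n _ n _ _ n _ n]) (rule mat_diag_dim)+
  also have "\<dots> = four_block_mat (1\<^sub>m n) (0\<^sub>m n n) (0\<^sub>m n n) (1\<^sub>m n)"
    unfolding prod add using cs by (intro cong_four_block_mat one zero) (auto simp: add.commute)
  finally have "block_reflection n c * block_reflection n c = four_block_mat (1\<^sub>m n) (0\<^sub>m n n) (0\<^sub>m n n) (1\<^sub>m n)" .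
  then show ?thesis
    using block_reflection_carrier block_reflection_adjoint by (intro unitary_matsI) auto
qed

lemma block_reflection_mult_vec:
  assumes "v \<in> carrier_vec n" "w \<in> carrier_vec n"
  shows "block_reflection n c *\<^sub>v (v @\<^sub>v w) =
    (real_diag n c *\<^sub>v v + real_diag n (\<lambda>i. sqrt (1 - (c i)\<^sup>2)) *\<^sub>v w) @\<^sub>v
    (real_diag n (\<lambda>i. sqrt (1 - (c i)\<^sup>2)) *\<^sub>v v + real_diag n (\<lambda>i. - c i) *\<^sub>v w)"
  unfolding block_reflection_def Let_def
  by (rule four_block_mat_mult_vec[of _ n n _ n _ n]) (use assms in auto)

lemma qform_zero_mat: "v \<in> carrier_vec n \<Longrightarrow> qform (0\<^sub>m n n) v = 0"
proof -
  assume "v \<in> carrier_vec n"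
  then have "0\<^sub>m n n *\<^sub>v v = 0\<^sub>v n" by (intro eq_vecI) auto
  then show ?thesis using \<open>v \<in> carrier_vec n\<close> by (simp add: qform_def)
qed

lemma zero_psd: "0\<^sub>m n n \<in> psd_mats n"
proof -
  have "mat_adjoint (0\<^sub>m n n) = (0\<^sub>m n n :: complex mat)" by (intro eq_matI) auto
  then show ?thesis by (simp add: psd_iff_qform qform_zero_mat)
qed

lemma operator_monotoneD:
  assumes "operator_monotone h" "A \<in> psd_mats n" "B \<in> psd_mats n"
    and "\<And>v. v \<in> carrier_vec n \<Longrightarrow> qform A v \<le> qform B v"
    and "\<And>x. 0 \<le> x \<Longrightarrow> 0 \<le> h x" "v \<in> carrier_vec n"
  shows "qform (mat_fun h A) v \<le> qform (mat_fun h B) v"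
proof -
  have "B - A \<in> psd_mats n"
    using psd_diff_iff[of A n B] psdD[OF assms(2)] psdD[OF assms(3)] assms(4) by blast
  then have "mat_fun h B - mat_fun h A \<in> psd_mats n"
    using assms(1-3) by (auto simp: operator_monotone_def)
  then show ?thesis
    using psd_diff_iff[of "mat_fun h A" n "mat_fun h B"] psdD[OF mat_fun_psd[OF assms(2)], of h]
      psdD[OF mat_fun_psd[OF assms(3)], of h] assms(5,6) by blast
qed

text \<open>Hansen's inequality with a factor \<open>1 + t\<close> on the right. Let \<open>U\<close> be the dilation of \<open>C = diag c\<close>.
Young's inequality bounds \<open>U (X \<oplus> 0) U\<close> by the block diagonal matrix with corners \<open>(1 + t) C X C\<close> and
\<open>(1 + 1/t) S X S\<close>, where \<open>S\<close> is the off-diagonal block of \<open>U\<close>. Operator monotonicity for matrices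
of size \<open>2n\<close> transfers this bound to \<open>h\<close>, which acts blockwise, and comparing the upper left corners
gives the claim. The lower corner \<open>h(0)\<close> contributes a nonnegative term to the smaller side.\<close>

lemma hansen_perturbed:
  assumes mono: "operator_monotone h" and nonneg: "\<And>x. 0 \<le> x \<Longrightarrow> 0 \<le> h x"
    and X: "X \<in> psd_mats n" and c: "\<And>i. i < n \<Longrightarrow> 0 \<le> c i \<and> c i \<le> 1"
    and t: "0 < t" and v: "v \<in> carrier_vec n"
  defines "D \<equiv> real_diag n (\<lambda>i. sqrt (1 + t) * c i)"
  shows "qform (mat_fun h X) (real_diag n c *\<^sub>v v) \<le> qform (mat_fun h (D * X * D)) v"
proof -
  define s where "s i = sqrt (1 - (c i)\<^sup>2)" for i
  define E where "E = real_diag n (\<lambda>i. sqrt (1 + 1 / t) * s i)"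
  let ?U = "block_reflection n c"
  have U: "?U \<in> unitary_mats (n + n)" using c by (rule block_reflection_unitary)
  note u = unitary_matsD[OF U]
  \<comment> \<open>the dilated bound is \<open>?U * XX * ?U \<le> Y\<close>\<close>
  define XX where "XX = dsum X (0\<^sub>m n n)"
  define Y where "Y = dsum (D * X * D) (E * X * E)"
  have XX: "XX \<in> psd_mats (n + n)" unfolding XX_def by (rule dsum_psd[OF X zero_psd])
  have UX: "?U * XX * ?U \<in> psd_mats (n + n)"
    using psd_congruence[OF XX u(1)] by (simp add: block_reflection_adjoint)
  have DXD: "D * X * D \<in> psd_mats n" and EXE: "E * X * E \<in> psd_mats n"
    unfolding D_def E_def by (intro real_diag_psd_congruence X)+
  have Y: "Y \<in> psd_mats (n + n)" unfolding Y_def by (rule dsum_psd[OF DXD EXE])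
  have qU: "qform (?U * Z * ?U) v = qform Z (?U *\<^sub>v v)"
    if "Z \<in> carrier_mat (n + n) (n + n)" "v \<in> carrier_vec (n + n)" for Z v
    using qform_congruence[OF that(1) u(1) that(2)] by (simp add: block_reflection_adjoint)
  have le: "qform (?U * XX * ?U) z \<le> qform Y z" if "z \<in> carrier_vec (n + n)" for z
  proof -
    have "\<forall>z \<in> carrier_vec (n + n). qform (?U * XX * ?U) z \<le> qform Y z"
      unfolding all_vec_append
    proof (intro ballI)
      fix x y :: "complex vec" assume x: "x \<in> carrier_vec n" and y: "y \<in> carrier_vec n"
      have "qform (?U * XX * ?U) (x @\<^sub>v y) = qform X (real_diag n c *\<^sub>v x + real_diag n s *\<^sub>v y)"
      proof -
        define z where "z = real_diag n s *\<^sub>v x + real_diag n (\<lambda>i. - c i) *\<^sub>v y"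
        have z: "z \<in> carrier_vec n"
          unfolding z_def using x y by (intro add_carrier_vec real_diag_mult_vec_carrier)
        have "?U *\<^sub>v (x @\<^sub>v y) = (real_diag n c *\<^sub>v x + real_diag n s *\<^sub>v y) @\<^sub>v z"
          unfolding block_reflection_mult_vec[OF x y] s_def z_def ..
        then show ?thesis
          using x y z psdD(1)[OF XX] psdD(1)[OF X] by (simp add: qU XX_def qform_dsum[of _ n _ n] qform_zero_mat)
      qed
      also have "\<dots> \<le> (1 + t) * qform X (real_diag n c *\<^sub>v x) + (1 + 1 / t) * qform X (real_diag n s *\<^sub>v y)"
        using x y by (intro qform_young[OF X _ _ t]) auto
      also have "\<dots> = qform Y (x @\<^sub>v y)"
        using x y psdD(1)[OF X] psdD(1)[OF DXD] psdD(1)[OF EXE] t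
        unfolding Y_def qform_dsum[OF psdD(1)[OF DXD] psdD(1)[OF EXE] x y]
        unfolding D_def E_def qform_real_diag_congruence[OF psdD(1)[OF X] x]
          qform_real_diag_congruence[OF psdD(1)[OF X] y]
          qform_scale_real_diag[OF psdD(1)[OF X] x] qform_scale_real_diag[OF psdD(1)[OF X] y]
        by simp
      finally show "qform (?U * XX * ?U) (x @\<^sub>v y) \<le> qform Y (x @\<^sub>v y)" .
    qed
    then show ?thesis using that by blast
  qed
  have hX: "mat_fun h X \<in> psd_mats n" and h0: "mat_fun h (0\<^sub>m n n) \<in> psd_mats n"
    using X zero_psd nonneg by (blast intro: mat_fun_psd)+
  have hD: "mat_fun h (D * X * D) \<in> carrier_mat n n" and hE: "mat_fun h (E * X * E) \<in> carrier_mat n n"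
    by (rule psdD(1)[OF mat_fun_psd[OF DXD nonneg]], assumption)
       (rule psdD(1)[OF mat_fun_psd[OF EXE nonneg]], assumption)
  have z0: "0\<^sub>v n \<in> carrier_vec n" by simp
  have "qform (mat_fun h X) (real_diag n c *\<^sub>v v)
      \<le> qform (mat_fun h X) (real_diag n c *\<^sub>v v) + qform (mat_fun h (0\<^sub>m n n)) (real_diag n s *\<^sub>v v)"
    using psdD(3)[OF h0] v by simp
  also have "\<dots> = qform (dsum (mat_fun h X) (mat_fun h (0\<^sub>m n n))) (?U *\<^sub>v (v @\<^sub>v 0\<^sub>v n))"
  proof -
    have "?U *\<^sub>v (v @\<^sub>v 0\<^sub>v n) = (real_diag n c *\<^sub>v v) @\<^sub>v (real_diag n s *\<^sub>v v)"
    proof -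
      have 0: "real_diag n d *\<^sub>v 0\<^sub>v n = 0\<^sub>v n" for d
        by (intro eq_vecI) (auto simp: real_diag_mult_vec)
      show ?thesis
        unfolding block_reflection_mult_vec[OF v z0] 0 s_def using v by simp
    qed
    then show ?thesis using psdD(1)[OF hX] psdD(1)[OF h0] v by (simp add: qform_dsum[of _ n _ n])
  qed
  also have "\<dots> = qform (mat_fun h (?U * XX * ?U)) (v @\<^sub>v 0\<^sub>v n)"
    using mat_fun_unitary_conj[OF U XX, of h] psdD(1)[OF mat_fun_psd[OF XX nonneg]] v
    by (simp add: block_reflection_adjoint qU XX_def mat_fun_dsum[OF X zero_psd])
  also have "\<dots> \<le> qform (mat_fun h Y) (v @\<^sub>v 0\<^sub>v n)"
    using v by (intro operator_monotoneD[OF mono UX Y le nonneg]) auto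
  also have "\<dots> = qform (mat_fun h (D * X * D)) v"
    using hD hE v by (simp add: Y_def mat_fun_dsum[OF DXD EXE] qform_dsum[of _ n _ n])
      (simp add: qform_def)
  finally show ?thesis .
qed

text \<open>Apply the perturbed inequality to the smaller contraction \<open>c / sqrt (1 + t)\<close>, which moves the factor
\<open>1 + t\<close> outside of \<open>h\<close>, where it can be sent to \<open>1\<close>.\<close>

theorem hansen_diagonal:
  assumes mono: "operator_monotone h" and nonneg: "\<And>x. 0 \<le> x \<Longrightarrow> 0 \<le> h x"
    and X: "X \<in> psd_mats n" and c: "\<And>i. i < n \<Longrightarrow> 0 \<le> c i \<and> c i \<le> 1" and v: "v \<in> carrier_vec n"
  shows "qform (mat_fun h X) (real_diag n c *\<^sub>v v) \<le> qform (mat_fun h (real_diag n c * X * real_diag n c)) v"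
    (is "?l \<le> ?r")
proof -
  have "?l \<le> (1 + t) * ?r" if t: "0 < t" for t
  proof -
    define r where "r = sqrt (1 + t)"
    have r: "1 < r" using t by (simp add: r_def)
    have "0 \<le> c i / r \<and> c i / r \<le> 1" if "i < n" for i
    proof -
      have "c i \<le> 1 * r" using c[OF that] r by linarith
      then show ?thesis using c[OF that] r by (simp add: divide_le_eq)
    qed
    from hansen_perturbed[OF mono nonneg X this t v]
    have "qform (mat_fun h X) (real_diag n (\<lambda>i. c i / r) *\<^sub>v v) \<le> ?r"
      using r by (simp add: r_def[symmetric])
    moreover have "qform (mat_fun h X) (real_diag n (\<lambda>i. 1 / r * c i) *\<^sub>v v) = (1 / r)\<^sup>2 * ?l"
      using psdD(1)[OF mat_fun_psd[OF X nonneg]] v by (rule qform_scale_real_diag)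
    moreover have "(1 / r)\<^sup>2 = 1 / (1 + t)" using t by (simp add: r_def power_divide)
    ultimately have "?l / (1 + t) \<le> ?r" by simp
    then show ?thesis using t by (simp add: field_simps)
  qed
  then have "\<forall>\<^sub>F t in at_right 0. ?l \<le> (1 + t) * ?r"
    by (auto simp: eventually_at_right_less intro: eventually_mono[OF eventually_at_right_less])
  moreover have "((\<lambda>t. (1 + t) * ?r) \<longlongrightarrow> (1 + 0) * ?r) (at_right 0)"
    by (intro tendsto_intros)
  ultimately show ?thesis
    using tendsto_lowerbound[of "\<lambda>t. (1 + t) * ?r" "(1 + 0) * ?r" "at_right 0" ?l] by simp
qed

section \<open>Operator means of shifted matrices\<close>

lemma unitary_conj_mult:
  assumes U: "U \<in> unitary_mats n" and "P \<in> carrier_mat n n" "Q \<in> carrier_mat n n"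
  shows "(U * P * mat_adjoint U) * (U * Q * mat_adjoint U) = U * (P * Q) * mat_adjoint U"
proof -
  note u = unitary_matsD[OF U]
  have "(U * P * mat_adjoint U) * (U * Q * mat_adjoint U) = U * (P * ((mat_adjoint U * U) * (Q * mat_adjoint U)))"
    using u(1) assms(2,3) by (simp add: square_mult_assoc[of _ n])
  then show ?thesis
    using u assms(2,3) by (simp add: square_mult_assoc[of _ n] left_mult_one_mat[of _ n n])
qed

lemma unitary_conj_shift:
  assumes U: "U \<in> unitary_mats n" and X: "X \<in> carrier_mat n n"
  shows "U * (X + c \<cdot>\<^sub>m 1\<^sub>m n) * mat_adjoint U = U * X * mat_adjoint U + c \<cdot>\<^sub>m 1\<^sub>m n"
proof -
  note u = unitary_matsD[OF U]
  have "U * (X + c \<cdot>\<^sub>m 1\<^sub>m n) = U * X + c \<cdot>\<^sub>m U"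
    using u(1) X mult_smult_distrib[OF u(1) one_carrier_mat, of c]
    by (simp add: mult_add_distrib_mat[of _ n n _ n])
  then show ?thesis
    using u X mult_smult_assoc_mat[OF u(1) adjoint_carrier[OF u(1)], of c]
    by (simp add: add_mult_distrib_mat[of _ n n _ _ n])
qed

lemma real_diag_cong: "(\<And>i. i < n \<Longrightarrow> f i = g i) \<Longrightarrow> real_diag n f = real_diag n g"
  by (intro eq_matI) (auto simp: mat_diag_def)

lemma adjoint_one [simp]: "mat_adjoint (1\<^sub>m n) = (1\<^sub>m n :: complex mat)"
  by (intro eq_matI) auto

lemma one_psd: "1\<^sub>m n \<in> psd_mats n"
  using psd_spectralI[of "1\<^sub>m n" n "\<lambda>_. 1"] by (simp add: unitary_mats_def)

lemma shift_psd:
  assumes B: "B \<in> psd_mats n" and e: "0 \<le> e"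
  shows "B + complex_of_real e \<cdot>\<^sub>m 1\<^sub>m n \<in> psd_mats n"
    and "v \<in> carrier_vec n \<Longrightarrow> qform (B + complex_of_real e \<cdot>\<^sub>m 1\<^sub>m n) v = qform B v + e * qform (1\<^sub>m n) v"
proof -
  note b = psdD[OF B]
  show q: "qform (B + complex_of_real e \<cdot>\<^sub>m 1\<^sub>m n) v = qform B v + e * qform (1\<^sub>m n) v"
    if "v \<in> carrier_vec n" for v
    using b(1) that by (simp add: qform_add[of _ n] qform_smult[of _ n])
  have "mat_adjoint (B + complex_of_real e \<cdot>\<^sub>m 1\<^sub>m n) = B + complex_of_real e \<cdot>\<^sub>m 1\<^sub>m n"
  proof (intro eq_matI)
    fix i j assume "i < dim_row (B + complex_of_real e \<cdot>\<^sub>m 1\<^sub>m n)" "j < dim_col (B + complex_of_real e \<cdot>\<^sub>m 1\<^sub>m n)"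
    then show "mat_adjoint (B + complex_of_real e \<cdot>\<^sub>m 1\<^sub>m n) $$ (i, j) = (B + complex_of_real e \<cdot>\<^sub>m 1\<^sub>m n) $$ (i, j)"
      using b(1) arg_cong[OF b(2), of "\<lambda>M. M $$ (i, j)"] by auto
  qed (use b(1) in auto)
  then show "B + complex_of_real e \<cdot>\<^sub>m 1\<^sub>m n \<in> psd_mats n"
    using b psdD(3)[OF one_psd] e by (auto simp: psd_iff_qform q)
qed

text \<open>In an eigenbasis of \<open>A\<close> the two square roots in the definition of the mean become diagonal matrices,
because the functional calculus commutes with unitary conjugation.\<close>

lemma inv_op_mean_spectral:
  fixes a :: "nat \<Rightarrow> real"
  assumes W: "W \<in> unitary_mats n" and A: "A = W * real_diag n a * mat_adjoint W" and B: "B \<in> psd_mats n"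
  defines "R \<equiv> real_diag n (\<lambda>i. sqrt (a i))" and "S \<equiv> real_diag n (\<lambda>i. 1 / sqrt (a i))"
  shows "inv_op_mean h A B = W * (R * mat_fun h (S * (mat_adjoint W * B * W) * S) * R) * mat_adjoint W"
proof -
  note w = unitary_matsD[OF W]
  have R: "R \<in> carrier_mat n n" and S: "S \<in> carrier_mat n n" by (simp_all add: R_def S_def)
  define B' where "B' = mat_adjoint W * B * W"
  have B': "B' \<in> psd_mats n" unfolding B'_def by (rule psd_congruence[OF B w(1)])
  have B_eq: "B = W * B' * mat_adjoint W"
    using conj_unitary_cancel[OF W psdD(1)[OF B]] by (simp add: B'_def)
  have SBS: "S * B' * S \<in> psd_mats n" unfolding S_def by (rule real_diag_psd_congruence[OF B'])
  have c: "mat_fun h (S * B' * S) \<in> carrier_mat n n"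
    using psd_spectral[OF SBS] mat_fun_spectral[of _ n "S * B' * S" _ h] w
    by (metis adjoint_carrier mat_diag_dim square_mult_carrier unitary_matsD(1))
  have "inv_op_mean h A B = (W * R * mat_adjoint W) *
      mat_fun h ((W * S * mat_adjoint W) * B * (W * S * mat_adjoint W)) * (W * R * mat_adjoint W)"
    unfolding inv_op_mean_def Let_def R_def S_def mat_fun_spectral[OF W A] ..
  also have "(W * S * mat_adjoint W) * B * (W * S * mat_adjoint W) = W * (S * B' * S) * mat_adjoint W"
    unfolding B_eq using S psdD(1)[OF B'] by (simp add: unitary_conj_mult[OF W])
  also have "mat_fun h \<dots> = W * mat_fun h (S * B' * S) * mat_adjoint W"
    by (rule mat_fun_unitary_conj[OF W SBS])
  finally show ?thesis
    using R c by (simp add: unitary_conj_mult[OF W] B'_def)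
qed

lemma inv_op_mean_psd:
  assumes A: "A \<in> psd_mats n" and B: "B \<in> psd_mats n" and nonneg: "\<And>x. 0 \<le> x \<Longrightarrow> 0 \<le> h x"
  shows "inv_op_mean h A B \<in> psd_mats n"
proof -
  obtain W a where W: "W \<in> unitary_mats n" and a: "A = W * real_diag n a * mat_adjoint W"
    using psd_spectral[OF A] by metis
  note w = unitary_matsD[OF W]
  let ?X = "real_diag n (\<lambda>i. 1 / sqrt (a i)) * (mat_adjoint W * B * W) * real_diag n (\<lambda>i. 1 / sqrt (a i))"
  let ?Y = "real_diag n (\<lambda>i. sqrt (a i)) * mat_fun h ?X * real_diag n (\<lambda>i. sqrt (a i))"
  have "?X \<in> psd_mats n" by (intro real_diag_psd_congruence psd_congruence[OF B w(1)])
  then have "mat_fun h ?X \<in> psd_mats n" using nonneg by (rule mat_fun_psd)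
  then have "?Y \<in> psd_mats n" by (rule real_diag_psd_congruence)
  from psd_congruence[OF this adjoint_carrier[OF w(1)]] show ?thesis
    unfolding inv_op_mean_spectral[OF W a B] by simp
qed

text \<open>Write \<open>X\<^sub>\<epsilon> = (A + \<epsilon> I)^(-1/2) (B + \<epsilon> I) (A + \<epsilon> I)^(-1/2)\<close> and let \<open>K\<close> be the contraction
\<open>(A + \<delta> I)^(-1/2) (A + \<epsilon> I)^(1/2)\<close>. Hansen's inequality and then operator monotonicity give
\<open>K h(X\<^sub>\<epsilon>) K \<le> h(K X\<^sub>\<epsilon> K) \<le> h(X\<^sub>\<delta>)\<close>, since \<open>K X\<^sub>\<epsilon> K\<close> differs from \<open>X\<^sub>\<delta>\<close> only by having \<open>B + \<epsilon> I\<close> in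
place of \<open>B + \<delta> I\<close>. Conjugation with \<open>(A + \<delta> I)^(1/2)\<close> yields the claim.\<close>

theorem inv_op_mean_shift_mono:
  assumes mono: "operator_monotone h" and nonneg: "\<And>x. 0 \<le> x \<Longrightarrow> 0 \<le> h x"
    and A: "A \<in> psd_mats n" and B: "B \<in> psd_mats n" and e: "0 < e" "e \<le> \<delta>" and v: "v \<in> carrier_vec n"
  shows "qform (inv_op_mean h (A + complex_of_real e \<cdot>\<^sub>m 1\<^sub>m n) (B + complex_of_real e \<cdot>\<^sub>m 1\<^sub>m n)) v
       \<le> qform (inv_op_mean h (A + complex_of_real \<delta> \<cdot>\<^sub>m 1\<^sub>m n) (B + complex_of_real \<delta> \<cdot>\<^sub>m 1\<^sub>m n)) v"
proof -
  obtain W a where W: "W \<in> unitary_mats n" and a: "A = W * real_diag n a * mat_adjoint W"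
    and a0: "\<And>i. i < n \<Longrightarrow> 0 \<le> a i"
    using psd_spectral[OF A] by metis
  note w = unitary_matsD[OF W]
  define B' where "B' x = mat_adjoint W * B * W + complex_of_real x \<cdot>\<^sub>m 1\<^sub>m n" for x
  define S where "S x = real_diag n (\<lambda>i. 1 / sqrt (a i + x))" for x
  define R where "R x = real_diag n (\<lambda>i. sqrt (a i + x))" for x
  define u where "u = mat_adjoint W *\<^sub>v v"
  have u: "u \<in> carrier_vec n" unfolding u_def using w(1) v by (intro mult_mat_vec_carrier adjoint_carrier)
  have WBW: "mat_adjoint W * B * W \<in> psd_mats n" by (rule psd_congruence[OF B w(1)])
  have B': "B' x \<in> psd_mats n" if "0 \<le> x" for x
    unfolding B'_def by (rule shift_psd(1)[OF WBW that])
  have X: "S y * B' x * S y \<in> psd_mats n" if "0 \<le> x" for x y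
    unfolding S_def by (rule real_diag_psd_congruence[OF B'[OF that]])
  have q: "qform (inv_op_mean h (A + complex_of_real x \<cdot>\<^sub>m 1\<^sub>m n) (B + complex_of_real x \<cdot>\<^sub>m 1\<^sub>m n)) v
      = qform (mat_fun h (S x * B' x * S x)) (R x *\<^sub>v u)" if x: "0 \<le> x" for x
  proof -
    have "real_diag n a + complex_of_real x \<cdot>\<^sub>m 1\<^sub>m n = real_diag n (\<lambda>i. a i + x)"
      by (intro eq_matI) (auto simp: mat_diag_def)
    then have A': "A + complex_of_real x \<cdot>\<^sub>m 1\<^sub>m n = W * real_diag n (\<lambda>i. a i + x) * mat_adjoint W"
      using unitary_conj_shift[OF W, of "real_diag n a" "complex_of_real x"] by (simp add: a)
    have B'': "mat_adjoint W * (B + complex_of_real x \<cdot>\<^sub>m 1\<^sub>m n) * W = B' x"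
      using unitary_conj_shift[OF unitary_adjoint[OF W] psdD(1)[OF B]] by (simp add: B'_def)
    have hX: "mat_fun h (S x * B' x * S x) \<in> carrier_mat n n"
      by (rule psdD(1)[OF mat_fun_psd[OF X[OF x] nonneg]]) assumption
    have "qform (inv_op_mean h (A + complex_of_real x \<cdot>\<^sub>m 1\<^sub>m n) (B + complex_of_real x \<cdot>\<^sub>m 1\<^sub>m n)) v
        = qform (mat_adjoint (mat_adjoint W) * (R x * mat_fun h (S x * B' x * S x) * R x) * mat_adjoint W) v"
      unfolding inv_op_mean_spectral[OF W A' shift_psd(1)[OF B x]] B'' S_def R_def by simp
    also have "\<dots> = qform (R x * mat_fun h (S x * B' x * S x) * R x) u"
      unfolding u_def using hX w(1) v by (intro qform_congruence) (auto simp: R_def)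
    also have "\<dots> = qform (mat_fun h (S x * B' x * S x)) (R x *\<^sub>v u)"
      unfolding R_def by (rule qform_real_diag_congruence[OF hX u])
    finally show ?thesis .
  qed
  \<comment> \<open>the diagonal entries of the contraction \<open>K\<close> in the eigenbasis of \<open>A\<close>\<close>
  define c where "c i = sqrt ((a i + e) / (a i + \<delta>))" for i
  have c: "0 \<le> c i \<and> c i \<le> 1" "c i * sqrt (a i + \<delta>) = sqrt (a i + e)"
      "c i * (1 / sqrt (a i + e)) = 1 / sqrt (a i + \<delta>)" if "i < n" for i
    using a0[OF that] e by (auto simp: c_def real_sqrt_divide divide_le_eq)
  have Ru: "R e *\<^sub>v u = real_diag n c *\<^sub>v (R \<delta> *\<^sub>v u)"
    using u c(2) by (intro eq_vecI) (auto simp: R_def real_diag_mult_vec mult.assoc[symmetric] simp flip: of_real_mult)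
  have cS: "real_diag n c * S e = S \<delta>" and Sc: "S e * real_diag n c = S \<delta>"
    unfolding S_def mat_diag_diag of_real_mult[symmetric]
    by (rule real_diag_cong, use c(3) in simp)+
  have "qform (mat_fun h (S e * B' e * S e)) (R e *\<^sub>v u)
      \<le> qform (mat_fun h (real_diag n c * (S e * B' e * S e) * real_diag n c)) (R \<delta> *\<^sub>v u)"
    unfolding Ru using e u c(1) by (intro hansen_diagonal mono nonneg X) (auto simp: R_def)
  also have "real_diag n c * (S e * B' e * S e) * real_diag n c = (real_diag n c * S e) * B' e * (S e * real_diag n c)"
    using psdD(1)[OF B', of e] e by (simp add: S_def square_mult_assoc[of _ n] del: mat_diag_diag)
  also have "\<dots> = S \<delta> * B' e * S \<delta>" unfolding cS Sc ..
  also have "qform (mat_fun h \<dots>) (R \<delta> *\<^sub>v u) \<le> qform (mat_fun h (S \<delta> * B' \<delta> * S \<delta>)) (R \<delta> *\<^sub>v u)"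
  proof (rule operator_monotoneD[OF mono X X _ nonneg])
    fix z :: "complex vec" assume z: "z \<in> carrier_vec n"
    let ?y = "S \<delta> *\<^sub>v z"
    have y: "?y \<in> carrier_vec n" unfolding S_def using z by (rule real_diag_mult_vec_carrier)
    from psdD(3)[OF one_psd y] have "qform (B' e) ?y \<le> qform (B' \<delta>) ?y"
      using e unfolding B'_def by (simp add: shift_psd(2)[OF WBW _ y] mult_right_mono)
    moreover have "qform (S \<delta> * B' x * S \<delta>) z = qform (B' x) ?y" if "0 \<le> x" for x
      unfolding S_def by (rule qform_real_diag_congruence[OF psdD(1)[OF B'[OF that]] z])
    ultimately show "qform (S \<delta> * B' e * S \<delta>) z \<le> qform (S \<delta> * B' \<delta> * S \<delta>) z"
      using e by simp
  qed (use e u in \<open>auto simp: R_def\<close>)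
  finally show ?thesis using q[of e] q[of \<delta>] e by simp
qed

section \<open>Monotone limits of positive semidefinite matrices\<close>

lemma mono_nonneg_limit_at_right:
  fixes f :: "real \<Rightarrow> real"
  assumes mono: "\<And>x y. 0 < x \<Longrightarrow> x \<le> y \<Longrightarrow> f x \<le> f y" and nonneg: "\<And>x. 0 < x \<Longrightarrow> 0 \<le> f x"
  shows "\<exists>l. (f \<longlongrightarrow> l) (at_right 0)"
proof -
  let ?l = "Inf (f ` {0<..})"
  have bdd: "bdd_below (f ` {0<..})" using nonneg by (auto intro!: bdd_belowI[of _ 0])
  have "(f \<longlongrightarrow> ?l) (at_right 0)"
  proof (rule order_tendstoI)
    fix z assume "z < ?l"
    then have "z < f x" if "0 < x" for x
      using cInf_lower[OF _ bdd, of "f x"] that by fastforce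
    then show "\<forall>\<^sub>F x in at_right 0. z < f x"
      by (auto intro: eventually_mono[OF eventually_at_right_less])
  next
    fix z assume "?l < z"
    then obtain y where y: "0 < y" "f y < z"
      using cInf_less_iff[of "f ` {0<..}" z] bdd by auto
    then have "f x < z" if "0 < x" "x < y" for x
      using mono[of x y] that by linarith
    then show "\<forall>\<^sub>F x in at_right 0. f x < z"
      using y(1) unfolding eventually_at_right_field by blast
  qed
  then show ?thesis ..
qed

lemma unit_cinner:
  assumes M: "M \<in> carrier_mat n n" and "i < n" "j < n"
  shows "(M *\<^sub>v unit_vec n i) \<bullet>c unit_vec n j = (M :: complex mat) $$ (j, i)"
proof -
  have "conjugate (unit_vec n j) = (unit_vec n j :: complex vec)" by (intro eq_vecI) (auto simp: unit_vec_def)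
  then show ?thesis using assms by (simp add: scalar_prod_right_unit[of _ n])
qed

text \<open>Expresses an entry through finitely many values of the quadratic form, so that convergence of the form
at every vector gives convergence of the entries.\<close>

lemma hermitian_polarization:
  assumes M: "M \<in> carrier_mat n n" "mat_adjoint M = M" and ij: "i < n" "j < n"
  shows "M $$ (i, j) = Complex
    ((qform M (unit_vec n i + unit_vec n j) - qform M (unit_vec n i) - qform M (unit_vec n j)) / 2)
    (- (qform M (unit_vec n i + \<i> \<cdot>\<^sub>v unit_vec n j) - qform M (unit_vec n i) - qform M (\<i> \<cdot>\<^sub>v unit_vec n j)) / 2)"
proof -
  have sym: "M $$ (j, i) = cnj (M $$ (i, j))"
    using arg_cong[OF M(2), of "\<lambda>M. M $$ (j, i)"] ij M(1) by simp
  have 1: "Re ((M *\<^sub>v unit_vec n i) \<bullet>c unit_vec n j + (M *\<^sub>v unit_vec n j) \<bullet>c unit_vec n i) = 2 * Re (M $$ (i, j))"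
    using ij by (simp add: unit_cinner[OF M(1)] sym)
  have "(M *\<^sub>v unit_vec n i) \<bullet>c (\<i> \<cdot>\<^sub>v unit_vec n j) + (M *\<^sub>v (\<i> \<cdot>\<^sub>v unit_vec n j)) \<bullet>c unit_vec n i
     = - \<i> * M $$ (j, i) + \<i> * M $$ (i, j)"
  proof -
    have "(M *\<^sub>v unit_vec n i) \<bullet>c (\<i> \<cdot>\<^sub>v unit_vec n j) = - \<i> * ((M *\<^sub>v unit_vec n i) \<bullet>c unit_vec n j)"
      using M(1) by (simp add: conjugate_smult_vec)
    moreover have "(M *\<^sub>v (\<i> \<cdot>\<^sub>v unit_vec n j)) \<bullet>c unit_vec n i = \<i> * ((M *\<^sub>v unit_vec n j) \<bullet>c unit_vec n i)"
      using M(1) by (simp add: mult_mat_vec[OF M(1)])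
    ultimately show ?thesis using ij by (simp add: unit_cinner[OF M(1)])
  qed
  then have 2: "Re ((M *\<^sub>v unit_vec n i) \<bullet>c (\<i> \<cdot>\<^sub>v unit_vec n j) + (M *\<^sub>v (\<i> \<cdot>\<^sub>v unit_vec n j)) \<bullet>c unit_vec n i)
     = - 2 * Im (M $$ (i, j))"
    by (simp add: sym)
  show ?thesis
    using 1 2 qform_expand[OF M(1), of "unit_vec n i" "unit_vec n j"]
      qform_expand[OF M(1), of "unit_vec n i" "\<i> \<cdot>\<^sub>v unit_vec n j"]
    by (simp add: complex_eq_iff)
qed

lemma mono_psd_limit:
  fixes M :: "real \<Rightarrow> complex mat"
  assumes psd: "\<And>x. 0 < x \<Longrightarrow> M x \<in> psd_mats n"
    and mono: "\<And>x y v. 0 < x \<Longrightarrow> x \<le> y \<Longrightarrow> v \<in> carrier_vec n \<Longrightarrow> qform (M x) v \<le> qform (M y) v"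
    and ij: "i < n" "j < n"
  shows "\<exists>l. ((\<lambda>x. M x $$ (i, j)) \<longlongrightarrow> l) (at_right 0)"
proof -
  have "\<forall>v \<in> carrier_vec n. \<exists>l. ((\<lambda>x. qform (M x) v) \<longlongrightarrow> l) (at_right 0)"
  proof
    fix v :: "complex vec" assume "v \<in> carrier_vec n"
    then show "\<exists>l. ((\<lambda>x. qform (M x) v) \<longlongrightarrow> l) (at_right 0)"
      by (intro mono_nonneg_limit_at_right[of "\<lambda>x. qform (M x) v"] mono psdD(3)[OF psd])
  qed
  then obtain l where l: "\<And>v. v \<in> carrier_vec n \<Longrightarrow> ((\<lambda>x. qform (M x) v) \<longlongrightarrow> l v) (at_right 0)"
    by metis
  let ?u = "unit_vec n i :: complex vec" and ?w = "unit_vec n j :: complex vec"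
  have "((\<lambda>x. Complex
    ((qform (M x) (?u + ?w) - qform (M x) ?u - qform (M x) ?w) / 2)
    (- (qform (M x) (?u + \<i> \<cdot>\<^sub>v ?w) - qform (M x) ?u - qform (M x) (\<i> \<cdot>\<^sub>v ?w)) / 2)) \<longlongrightarrow>
    Complex ((l (?u + ?w) - l ?u - l ?w) / 2) (- (l (?u + \<i> \<cdot>\<^sub>v ?w) - l ?u - l (\<i> \<cdot>\<^sub>v ?w)) / 2)) (at_right 0)"
    by (intro tendsto_Complex tendsto_intros l) auto
  moreover have "\<forall>\<^sub>F x in at_right 0. Complex
    ((qform (M x) (?u + ?w) - qform (M x) ?u - qform (M x) ?w) / 2)
    (- (qform (M x) (?u + \<i> \<cdot>\<^sub>v ?w) - qform (M x) ?u - qform (M x) (\<i> \<cdot>\<^sub>v ?w)) / 2) = M x $$ (i, j)"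
  proof (rule eventually_mono[OF eventually_at_right_less])
    fix x :: real assume x: "0 < x"
    show "Complex
      ((qform (M x) (?u + ?w) - qform (M x) ?u - qform (M x) ?w) / 2)
      (- (qform (M x) (?u + \<i> \<cdot>\<^sub>v ?w) - qform (M x) ?u - qform (M x) (\<i> \<cdot>\<^sub>v ?w)) / 2) = M x $$ (i, j)"
      using hermitian_polarization[OF psdD(1,2)[OF psd[OF x]] ij] by (rule sym)
  qed
  ultimately show ?thesis by (intro exI) (rule Lim_transform_eventually)
qed

section \<open>Jensen's inequality for geometrically convex functions\<close>

lemma sum_consecutive_pairs: "(\<Sum>i<2 * n. x i) = (\<Sum>i<n. x (2 * i) + x (2 * i + 1))"
  for x :: "nat \<Rightarrow> real"
  by (induction n) auto

text \<open>Cauchy's forward-backward induction. Pairing the points proves the case \<open>2 m\<close> from the case \<open>m\<close>;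
for odd \<open>n\<close> the case \<open>n + 1\<close>, applied to the points together with their mean, gives the case \<open>n\<close>.\<close>

lemma midpoint_jensen:
  fixes f :: "real \<Rightarrow> real"
  assumes mid: "\<And>s t. f ((s + t) / 2) \<le> (f s + f t) / 2" and n: "1 \<le> n"
  shows "f ((\<Sum>i<n. x i) / real n) \<le> (\<Sum>i<n. f (x i)) / real n"
  using n
proof (induction n arbitrary: x rule: less_induct)
  case (less n)
  have double: "f ((\<Sum>i<2 * m. x i) / real (2 * m)) \<le> (\<Sum>i<2 * m. f (x i)) / real (2 * m)"
    if m: "1 \<le> m" "m < n" for m x
  proof -
    let ?y = "\<lambda>i. (x (2 * i) + x (2 * i + 1)) / 2"
    have "(\<Sum>i<2 * m. x i) / real (2 * m) = (\<Sum>i<m. ?y i) / real m"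
      by (simp add: sum_consecutive_pairs sum_divide_distrib[symmetric])
    also have "f \<dots> \<le> (\<Sum>i<m. f (?y i)) / real m"
      using less.IH[of m ?y] m by simp
    also have "\<dots> \<le> (\<Sum>i<m. (f (x (2 * i)) + f (x (2 * i + 1))) / 2) / real m"
      by (intro divide_right_mono sum_mono mid) simp
    also have "\<dots> = (\<Sum>i<2 * m. f (x i)) / real (2 * m)"
      by (simp add: sum_consecutive_pairs[of "\<lambda>i. f (x i)"] sum_divide_distrib[symmetric])
    finally show ?thesis .
  qed
  consider "n = 1" | m where "n = 2 * m" "1 \<le> m" "m < n" | m where "Suc n = 2 * m" "1 \<le> m" "m < n"
  proof (cases "n = 1")
    case False
    show ?thesis
    proof (cases "even n")
      case True
      then show ?thesis using that(2)[of "n div 2"] less.prems by auto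
    next
      case odd: False
      then show ?thesis using that(3)[of "Suc n div 2"] less.prems False by (auto elim!: oddE)
    qed
  qed (rule that(1))
  then show ?case
  proof cases
    case 1
    then show ?thesis by simp
  next
    case 2
    then show ?thesis using double[of m x] by simp
  next
    case 3
    define a where "a = (\<Sum>i<n. x i) / real n"
    define x' where "x' i = (if i < n then x i else a)" for i
    have s: "(\<Sum>i<n. x' i) = (\<Sum>i<n. x i)" "(\<Sum>i<n. f (x' i)) = (\<Sum>i<n. f (x i))"
      by (auto simp: x'_def intro!: sum.cong)
    have "(\<Sum>i<n. x i) = real n * a" using less.prems by (simp add: a_def)
    then have "(\<Sum>i<Suc n. x' i) = real (Suc n) * a"
      using s by (simp add: x'_def[of n] algebra_simps)
    then have "(\<Sum>i<Suc n. x' i) / real (Suc n) = a" by (simp del: sum.lessThan_Suc)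
    then have "f a \<le> (\<Sum>i<Suc n. f (x' i)) / real (Suc n)"
      using double[of m x'] 3 by metis
    also have "\<dots> = ((\<Sum>i<n. f (x i)) + f a) / real (Suc n)"
      using s by (simp add: x'_def[of n])
    finally have "real (Suc n) * f a \<le> (\<Sum>i<n. f (x i)) + f a"
      by (simp add: le_divide_eq mult.commute del: of_nat_Suc)
    then have "real n * f a \<le> (\<Sum>i<n. f (x i))" by (simp add: algebra_simps)
    then show ?thesis using less.prems by (simp add: a_def[symmetric] le_divide_eq mult.commute)
  qed
qed

lemma root_prod_exp:
  assumes "1 \<le> n" "\<And>i. i < n \<Longrightarrow> 0 < x i"
  shows "root n (\<Prod>i<n. x i) = exp ((\<Sum>i<n. ln (x i)) / real n)"
proof -
  have "(\<Prod>i<n. x i) = exp (\<Sum>i<n. ln (x i))"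
    using assms(2) by (simp add: exp_sum)
  also have "\<dots> = exp ((\<Sum>i<n. ln (x i)) / real n) ^ n"
    using assms(1) by (simp add: exp_of_nat_mult[symmetric])
  finally show ?thesis using assms(1) by (simp add: real_root_power_cancel)
qed

text \<open>Geometric convexity of \<open>h\<close> is midpoint convexity of \<open>t \<mapsto> ln (h (exp t))\<close>; positivity of \<open>h\<close> makes
this function meaningful. The concave case is the convex case for its negative.\<close>

lemma geometric_jensen:
  assumes pos: "\<And>x. 0 < x \<Longrightarrow> 0 < h x" and n: "1 \<le> n" and x: "\<And>i. i < n \<Longrightarrow> 0 < x i"
  shows "geometrically_convex_on {0..} h \<Longrightarrow> h (root n (\<Prod>i<n. x i)) \<le> root n (\<Prod>i<n. h (x i))"
    and "geometrically_concave_on {0..} h \<Longrightarrow> root n (\<Prod>i<n. h (x i)) \<le> h (root n (\<Prod>i<n. x i))"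
proof -
  let ?f = "\<lambda>t. ln (h (exp t))" and ?s = "(\<Sum>i<n. ln (x i)) / real n"
  have mid: "ln (h (sqrt (exp s * exp t))) = ?f ((s + t) / 2)"
    "ln (sqrt (h (exp s) * h (exp t))) = (?f s + ?f t) / 2" for s t
  proof -
    have "sqrt (exp s * exp t) = exp ((s + t) / 2)"
      by (rule real_sqrt_unique) (simp_all add: power2_eq_square mult_exp_exp)
    then show "ln (h (sqrt (exp s * exp t))) = ?f ((s + t) / 2)" by simp
    show "ln (sqrt (h (exp s) * h (exp t))) = (?f s + ?f t) / 2"
      using pos[of "exp s"] pos[of "exp t"] by (simp add: ln_sqrt ln_mult_pos)
  qed
  have spos: "0 < sqrt (h (exp s) * h (exp t))" "0 < h (sqrt (exp s * exp t))" for s t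
    using pos by simp_all
  have fx: "(\<Sum>i<n. ?f (ln (x i))) = (\<Sum>i<n. ln (h (x i)))" using x by simp
  have lhs: "root n (\<Prod>i<n. x i) = exp ?s" using n x by (rule root_prod_exp)
  have rhs: "root n (\<Prod>i<n. h (x i)) = exp ((\<Sum>i<n. ln (h (x i))) / real n)"
    using n x pos by (intro root_prod_exp) auto
  have h_eq: "exp (?f ?s) = h (exp ?s)" using pos by simp
  {
    assume "geometrically_convex_on {0..} h"
    then have "h (sqrt (exp s * exp t)) \<le> sqrt (h (exp s) * h (exp t))" for s t
      by (simp add: geometrically_convex_on_def)
    then have "?f ((s + t) / 2) \<le> (?f s + ?f t) / 2" for s t
      unfolding mid[symmetric] using spos by simp
    from midpoint_jensen[of ?f, OF this n, of "\<lambda>i. ln (x i)"]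
    have "exp (?f ?s) \<le> exp ((\<Sum>i<n. ln (h (x i))) / real n)" unfolding fx by simp
    then show "h (root n (\<Prod>i<n. x i)) \<le> root n (\<Prod>i<n. h (x i))"
      unfolding lhs rhs h_eq .
  }
  {
    assume "geometrically_concave_on {0..} h"
    then have "sqrt (h (exp s) * h (exp t)) \<le> h (sqrt (exp s * exp t))" for s t
      by (simp add: geometrically_concave_on_def)
    then have "(?f s + ?f t) / 2 \<le> ?f ((s + t) / 2)" for s t
      unfolding mid[symmetric] using spos by simp
    then have "- ?f ((s + t) / 2) \<le> (- ?f s + - ?f t) / 2" for s t by (simp add: field_simps)
    from midpoint_jensen[of "\<lambda>t. - ?f t", OF this n, of "\<lambda>i. ln (x i)"]
    have "exp ((\<Sum>i<n. ln (h (x i))) / real n) \<le> exp (?f ?s)" unfolding sum_negf fx by simp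
    then show "root n (\<Prod>i<n. h (x i)) \<le> h (root n (\<Prod>i<n. x i))"
      unfolding lhs rhs h_eq .
  }
qed

section \<open>Scalar means\<close>

lemma mat_fun_real_diag: "mat_fun f (real_diag n d) = real_diag n (\<lambda>i. f (d i))"
  using mat_fun_spectral[of "1\<^sub>m n" n "real_diag n d" d f]
  by (simp add: unitary_mats_def left_mult_one_mat[of _ n n] right_mult_one_mat[of _ n n])

lemma real_diag_psd: "(\<And>i. i < n \<Longrightarrow> 0 \<le> d i) \<Longrightarrow> real_diag n d \<in> psd_mats n"
  using psd_spectralI[of "1\<^sub>m n" n d]
  by (simp add: unitary_mats_def left_mult_one_mat[of _ n n] right_mult_one_mat[of _ n n])

lemma qform_real_diag_1: "qform (real_diag 1 d) (unit_vec 1 0) = d 0"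
  by (simp add: qform_real_diag[of _ 1, unfolded One_nat_def])

lemma representing_function_mono:
  assumes "representing_function h" "0 \<le> x" "x \<le> y"
  shows "h x \<le> h y"
proof -
  have "qform (mat_fun h (real_diag 1 (\<lambda>_. x))) (unit_vec 1 0) \<le> qform (mat_fun h (real_diag 1 (\<lambda>_. y))) (unit_vec 1 0)"
  proof (rule operator_monotoneD)
    show "operator_monotone h" "\<And>x. 0 \<le> x \<Longrightarrow> 0 \<le> h x"
      using assms(1) by (auto simp: representing_function_def)
    show "qform (real_diag 1 (\<lambda>_. x)) v \<le> qform (real_diag 1 (\<lambda>_. y)) v" if "v \<in> carrier_vec 1" for v
      using that assms by (simp only: qform_real_diag[OF that]) (auto intro!: sum_mono mult_right_mono)
    show "real_diag 1 (\<lambda>_. x) \<in> psd_mats 1" "real_diag 1 (\<lambda>_. y) \<in> psd_mats 1"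
      by (rule real_diag_psd, use assms in simp)+
  qed simp
  then show ?thesis unfolding mat_fun_real_diag qform_real_diag_1 .
qed

text \<open>This is the statement that \<open>h x / x\<close> decreases: Hansen's inequality for \<open>1 \<times> 1\<close> matrices with the
contraction \<open>sqrt (x / y)\<close>.\<close>

lemma representing_function_ratio_antimono:
  assumes "representing_function h" "0 < x" "x \<le> y"
  shows "x * h y \<le> y * h x"
proof -
  define c where "c = sqrt (x / y)"
  have c: "0 \<le> c" "c \<le> 1" "c\<^sup>2 = x / y"
    using assms by (auto simp: c_def)
  have "c * y * c = c\<^sup>2 * y" by (simp add: power2_eq_square)
  then have cyc: "c * y * c = x" using c(3) assms by simp
  let ?X = "real_diag 1 (\<lambda>_. y)" and ?C = "real_diag 1 (\<lambda>_. c)"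
  have "qform (mat_fun h ?X) (?C *\<^sub>v unit_vec 1 0) \<le> qform (mat_fun h (?C * ?X * ?C)) (unit_vec 1 0)"
    using assms c by (intro hansen_diagonal real_diag_psd) (auto simp: representing_function_def)
  also have "?C * ?X * ?C = real_diag 1 (\<lambda>_. x)"
    using cyc by (simp flip: of_real_mult)
  also have "?C *\<^sub>v unit_vec 1 0 = complex_of_real c \<cdot>\<^sub>v unit_vec 1 0"
    by (intro eq_vecI) (auto simp: real_diag_mult_vec)
  finally have "c\<^sup>2 * h y \<le> h x"
    unfolding mat_fun_real_diag qform_scale[OF real_diag_carrier unit_vec_carrier] qform_real_diag_1 .
  then show ?thesis using assms by (simp add: c(3) field_simps)
qed

text \<open>Since \<open>h 1 = 1\<close>, monotonicity of \<open>h\<close> bounds it below by \<open>1\<close> on \<open>[1, \<infinity>)\<close>, and the decrease of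
\<open>h x / x\<close> bounds it below by \<open>x\<close> on \<open>(0, 1]\<close>.\<close>

lemma representing_function_pos:
  assumes "representing_function h" "0 < x"
  shows "0 < h x"
proof (cases "x \<le> 1")
  case True
  then have "x * h 1 \<le> 1 * h x" using representing_function_ratio_antimono[OF assms(1,2) True] by simp
  then show ?thesis using assms by (simp add: representing_function_def)
next
  case False
  then have "h 1 \<le> h x" using representing_function_mono[OF assms(1), of 1 x] by simp
  then show ?thesis using assms by (simp add: representing_function_def)
qed

text \<open>The mean \<open>x \<sigma> y\<close> of two positive numbers.\<close>

definition perspective :: "(real \<Rightarrow> real) \<Rightarrow> real \<Rightarrow> real \<Rightarrow> real" where
  "perspective h x y = x * h (y / x)"

lemma perspective_mono:
  assumes h: "representing_function h" and "0 < x" "x \<le> x'" "0 < y" "y \<le> y'"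
  shows "perspective h x y \<le> perspective h x' y'"
proof -
  have "perspective h x y \<le> perspective h x' y"
  proof -
    have "y / x' \<le> y / x" using assms by (simp add: frac_le)
    then have "y / x' * h (y / x) \<le> y / x * h (y / x')"
      using assms by (intro representing_function_ratio_antimono[OF h]) auto
    then show ?thesis using assms by (simp add: perspective_def field_simps)
  qed
  also have "\<dots> \<le> perspective h x' y'"
    unfolding perspective_def using assms
    by (intro mult_left_mono representing_function_mono[OF h] divide_right_mono) auto
  finally show ?thesis .
qed

text \<open>The limit exists along every approach to a point of the closed quadrant, not only along
\<open>(a + \<epsilon>, b + \<epsilon>)\<close>. This generality is needed because the determinants of \<open>A + \<epsilon> I\<close> and \<open>B + \<epsilon> I\<close>
approach those of \<open>A\<close> and \<open>B\<close> along another curve. The upper bound comes from monotonicity. For the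
lower bound, a point \<open>(u, w)\<close> near \<open>(a, b)\<close> exceeds \<open>(k a, k b)\<close> in both coordinates for a given
\<open>k < 1\<close>, and homogeneity bounds the perspective there below by \<open>k\<close> times the infimum.\<close>

lemma perspective_tendsto:
  assumes h: "representing_function h" and ab: "0 \<le> a" "0 \<le> b"
    and u: "(u \<longlongrightarrow> a) F" "\<forall>\<^sub>F t in F. 0 < u t" and w: "(w \<longlongrightarrow> b) F" "\<forall>\<^sub>F t in F. 0 < w t"
  shows "((\<lambda>t. perspective h (u t) (w t)) \<longlongrightarrow> (INF (x, y) \<in> {a<..} \<times> {b<..}. perspective h x y)) F"
    (is "(_ \<longlongrightarrow> ?L) F")
proof -
  have nonneg: "0 \<le> perspective h x y" if "0 < x" "0 < y" for x y
    using representing_function_pos[OF h, of "y / x"] that by (simp add: perspective_def)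
  let ?S = "(\<lambda>(x, y). perspective h x y) ` ({a<..} \<times> {b<..})"
  have bdd: "bdd_below ?S"
    using ab by (auto intro!: bdd_belowI[of _ 0] nonneg)
  have ne: "?S \<noteq> {}" by (auto intro: gt_ex)
  have L_le: "?L \<le> perspective h x y" if "a < x" "b < y" for x y
    using cInf_lower[OF _ bdd, of "perspective h x y"] that by force
  show ?thesis
  proof (rule order_tendstoI)
    fix z assume "?L < z"
    then obtain x y where xy: "a < x" "b < y" "perspective h x y < z"
      using cInf_less_iff[OF ne bdd] by auto
    have "\<forall>\<^sub>F t in F. u t < x" "\<forall>\<^sub>F t in F. w t < y"
      using u(1) w(1) xy by (auto intro: order_tendstoD)
    with u(2) w(2) show "\<forall>\<^sub>F t in F. perspective h (u t) (w t) < z"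
    proof eventually_elim
      case (elim t)
      then show ?case using perspective_mono[OF h, of "u t" x "w t" y] xy by linarith
    qed
  next
    fix z assume z: "z < ?L"
    show "\<forall>\<^sub>F t in F. z < perspective h (u t) (w t)"
    proof (cases "z < 0")
      case True
      show ?thesis
        using u(2) w(2)
      proof eventually_elim
        case (elim t)
        then show ?case using nonneg[of "u t" "w t"] True by simp
      qed
    next
      case False
      \<comment> \<open>chosen so that \<open>k * ?L\<close> is the midpoint of \<open>z\<close> and \<open>?L\<close>\<close>
      define k where "k = (z + ?L) / (2 * ?L)"
      have k: "0 < k" "k < 1" "z < k * ?L"
        using z False by (auto simp: k_def field_simps)
      \<comment> \<open>for \<open>a > 0\<close> by convergence, for \<open>a = 0\<close> by positivity of \<open>u\<close>\<close>
      have "\<forall>\<^sub>F t in F. k * a < u t"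
        using order_tendstoD(1)[OF u(1), of "k * a"] u(2) ab k by (cases "a = 0") auto
      moreover have "\<forall>\<^sub>F t in F. k * b < w t"
        using order_tendstoD(1)[OF w(1), of "k * b"] w(2) ab k by (cases "b = 0") auto
      ultimately show ?thesis
      proof eventually_elim
        case (elim t)
        then have "?L \<le> perspective h (u t / k) (w t / k)"
          using k by (intro L_le) (auto simp: field_simps)
        also have "\<dots> = perspective h (u t) (w t) / k" using k by (simp add: perspective_def)
        finally have "k * ?L \<le> perspective h (u t) (w t)" using k by (simp add: field_simps)
        then show ?case using k by linarith
      qed
    qed
  qed
qed

section \<open>Determinants of operator means\<close>

lemma det_real_diag: "det (real_diag n d) = complex_of_real (\<Prod>i<n. d i)"
proof -
  have "det (real_diag n d) = prod_list (diag_mat (real_diag n d))"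
    by (rule det_upper_triangular[of _ n]) (auto simp: mat_diag_def)
  then show ?thesis by (simp add: prod_list_diag_prod mat_diag_def lessThan_atLeast0)
qed

lemma det_unitary_conj:
  assumes U: "U \<in> unitary_mats n" and X: "X \<in> carrier_mat n n"
  shows "det (U * X * mat_adjoint U) = det X"
proof -
  note u = unitary_matsD[OF U]
  have "det U * det (mat_adjoint U) = 1"
    using det_mult[OF u(1) adjoint_carrier[OF u(1)]] u(3) by simp
  then show ?thesis using u(1) X by (simp add: det_mult[of _ n])
qed

lemma psd_det_nonneg:
  assumes "A \<in> psd_mats n"
  shows "0 \<le> Re (det A)"
proof -
  obtain U d where U: "U \<in> unitary_mats n" and d: "A = U * real_diag n d * mat_adjoint U"
    and nonneg: "\<And>i. i < n \<Longrightarrow> 0 \<le> d i"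
    using psd_spectral[OF assms] by metis
  have "det A = complex_of_real (\<Prod>i<n. d i)"
    unfolding d det_unitary_conj[OF U real_diag_carrier] by (rule det_real_diag)
  moreover have "0 \<le> (\<Prod>i<n. d i)" using nonneg by (intro prod_nonneg) auto
  ultimately show ?thesis by (simp del: of_real_prod)
qed

lemma invertible_iff_det:
  assumes A: "A \<in> carrier_mat n n"
  shows "invertible_mat A \<longleftrightarrow> det A \<noteq> (0 :: complex)"
proof
  assume "invertible_mat A"
  then obtain B where AB: "A * B = 1\<^sub>m n" and BA: "B * A = 1\<^sub>m (dim_row B)"
    using A by (auto simp: invertible_mat_def inverts_mat_def)
  have "dim_col B = n" using arg_cong[OF AB, of dim_col] by simp
  moreover have "dim_row B = n" using arg_cong[OF BA, of dim_col] A by simp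
  ultimately have "B \<in> carrier_mat n n" by auto
  then have "det A * det B = 1" using det_mult[OF A] AB by (metis det_one)
  then show "det A \<noteq> 0" by auto
next
  assume "det A \<noteq> 0"
  from det_non_zero_imp_unit[OF A this, of "()"]
  obtain B where "B \<in> carrier_mat n n" "B * A = 1\<^sub>m n" "A * B = 1\<^sub>m n"
    unfolding Units_def ring_mat_def by auto
  then show "invertible_mat A"
    using A by (auto simp: invertible_mat_def inverts_mat_def)
qed

lemma det_shift_pos:
  assumes A: "A \<in> psd_mats n" and e: "0 < e"
  shows "det (A + complex_of_real e \<cdot>\<^sub>m 1\<^sub>m n) \<noteq> 0"
proof -
  obtain W a where W: "W \<in> unitary_mats n" and a: "A = W * real_diag n a * mat_adjoint W"
    and a0: "\<And>i. i < n \<Longrightarrow> 0 \<le> a i"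
    using psd_spectral[OF A] by metis
  have "real_diag n a + complex_of_real e \<cdot>\<^sub>m 1\<^sub>m n = real_diag n (\<lambda>i. a i + e)"
    by (intro eq_matI) (auto simp: mat_diag_def)
  then have A': "A + complex_of_real e \<cdot>\<^sub>m 1\<^sub>m n = W * real_diag n (\<lambda>i. a i + e) * mat_adjoint W"
    using unitary_conj_shift[OF W, of "real_diag n a" "complex_of_real e"] by (simp add: a)
  have "(\<Prod>i<n. a i + e) \<noteq> 0" using a0 e by (force simp: add_nonneg_pos)
  then show ?thesis
    unfolding A' det_unitary_conj[OF W real_diag_carrier] det_real_diag by (simp del: of_real_prod)
qed

text \<open>The numbers \<open>l i\<close> are the eigenvalues of \<open>A^(-1/2) B A^(-1/2)\<close>, and \<open>p\<close> is the determinant of \<open>A\<close>.\<close>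

lemma det_inv_op_mean:
  assumes A: "A \<in> psd_mats n" "det A \<noteq> 0" and B: "B \<in> psd_mats n" "det B \<noteq> 0"
    and nonneg: "\<And>x. 0 \<le> x \<Longrightarrow> 0 \<le> h x"
  shows "\<exists>p l. 0 < p \<and> (\<forall>i<n. 0 < l i) \<and> det A = complex_of_real p \<and>
    det B = complex_of_real (p * (\<Prod>i<n. l i)) \<and>
    det (inv_op_mean h A B) = complex_of_real (p * (\<Prod>i<n. h (l i)))"
proof -
  obtain W a where W: "W \<in> unitary_mats n" and a: "A = W * real_diag n a * mat_adjoint W"
    and a0: "\<And>i. i < n \<Longrightarrow> 0 \<le> a i"
    using psd_spectral[OF A(1)] by metis
  note w = unitary_matsD[OF W]
  define p where "p = (\<Prod>i<n. a i)"
  have detA: "det A = complex_of_real p"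
    unfolding a det_unitary_conj[OF W real_diag_carrier] p_def by (rule det_real_diag)
  then have "p \<noteq> 0" using A(2) by auto
  moreover have "0 \<le> p" unfolding p_def using a0 by (intro prod_nonneg) auto
  ultimately have p: "0 < p" by simp
  define R where "R = real_diag n (\<lambda>i. sqrt (a i))"
  define S where "S = real_diag n (\<lambda>i. 1 / sqrt (a i))"
  define B' where "B' = mat_adjoint W * B * W"
  have B': "B' \<in> psd_mats n" unfolding B'_def by (rule psd_congruence[OF B(1) w(1)])
  have X: "S * B' * S \<in> psd_mats n" unfolding S_def by (rule real_diag_psd_congruence[OF B'])
  obtain V l where V: "V \<in> unitary_mats n" and l: "S * B' * S = V * real_diag n l * mat_adjoint V"
    and l0: "\<And>i. i < n \<Longrightarrow> 0 \<le> l i"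
    using psd_spectral[OF X] by metis
  note v = unitary_matsD[OF V]
  have Rc: "R \<in> carrier_mat n n" and Sc: "S \<in> carrier_mat n n" by (simp_all add: R_def S_def)
  have sp: "(\<Prod>i<n. sqrt (a i)) = sqrt p" 
  proof -
    have "(\<Prod>i<m. sqrt (a i)) = sqrt (\<Prod>i<m. a i)" for m
      by (induction m) (simp_all add: real_sqrt_mult)
    then show ?thesis by (simp add: p_def)
  qed
  have detR: "det R = complex_of_real (sqrt p)" unfolding R_def det_real_diag sp ..
  have detS: "det S = complex_of_real (1 / sqrt p)"
    unfolding S_def det_real_diag prod_dividef sp by simp
  have detB': "det B' = det B"
    using det_unitary_conj[OF unitary_adjoint[OF W] psdD(1)[OF B(1)]] by (simp add: B'_def)
  have "complex_of_real (\<Prod>i<n. l i) = det (S * B' * S)"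
    unfolding l det_unitary_conj[OF V real_diag_carrier] by (rule det_real_diag[symmetric])
  also have "\<dots> = det S * det B' * det S"
    using Sc psdD(1)[OF B'] by (simp add: det_mult[of _ n])
  also have "\<dots> = det B / complex_of_real p"
    using p unfolding detS detB' by (simp add: field_simps flip: of_real_mult)
  finally have detB: "det B = complex_of_real (p * (\<Prod>i<n. l i))"
    using p by (simp add: field_simps del: of_real_prod)
  then have "(\<Prod>i<n. l i) \<noteq> 0" using B(2) by auto
  then have lpos: "0 < l i" if "i < n" for i
    using l0[OF that] that by (auto simp: less_le)
  have hX: "mat_fun h (S * B' * S) = V * real_diag n (\<lambda>i. h (l i)) * mat_adjoint V"
    by (rule mat_fun_spectral[OF V l])
  have hXc: "mat_fun h (S * B' * S) \<in> carrier_mat n n" unfolding hX using v(1) by simp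
  have "det (inv_op_mean h A B) = det (R * mat_fun h (S * B' * S) * R)"
    unfolding inv_op_mean_spectral[OF W a B(1)] R_def[symmetric] S_def[symmetric] B'_def[symmetric]
    using Rc hXc by (intro det_unitary_conj[OF W]) simp
  also have "\<dots> = det R * det (mat_fun h (S * B' * S)) * det R"
    using Rc hXc by (simp add: det_mult[of _ n])
  also have "det (mat_fun h (S * B' * S)) = complex_of_real (\<Prod>i<n. h (l i))"
    unfolding hX det_unitary_conj[OF V real_diag_carrier] by (rule det_real_diag)
  also have "det R * complex_of_real (\<Prod>i<n. h (l i)) * det R = complex_of_real (sqrt p * (\<Prod>i<n. h (l i)) * sqrt p)"
    unfolding detR by simp
  also have "sqrt p * (\<Prod>i<n. h (l i)) * sqrt p = p * (\<Prod>i<n. h (l i))"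
  proof -
    have "sqrt p * q * sqrt p = (sqrt p * sqrt p) * q" for q by (simp only: mult_ac)
    then show ?thesis using p by simp
  qed
  finally show ?thesis using p lpos detA detB by (intro exI[of _ p] exI[of _ l]) simp
qed

text \<open>The determinant inequality for invertible matrices: after cancelling \<open>root n (det A)\<close> on both sides it
is Jensen's inequality for the eigenvalues of \<open>A^(-1/2) B A^(-1/2)\<close>.\<close>

lemma det_root_inv_op_mean:
  assumes h: "representing_function h" and n: "1 \<le> n"
    and A: "A \<in> psd_mats n" "det A \<noteq> 0" and B: "B \<in> psd_mats n" "det B \<noteq> 0"
  shows "0 < det_root A" "0 < det_root B"
    "geometrically_convex_on {0..} h \<Longrightarrow>
      perspective h (det_root A) (det_root B) \<le> det_root (inv_op_mean h A B)"
    "geometrically_concave_on {0..} h \<Longrightarrow>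
      det_root (inv_op_mean h A B) \<le> perspective h (det_root A) (det_root B)"
proof -
  have nonneg: "\<And>x. 0 \<le> x \<Longrightarrow> 0 \<le> h x" using h by (simp add: representing_function_def)
  obtain p l where pl: "0 < p \<and> (\<forall>i<n. 0 < l i) \<and> det A = complex_of_real p \<and>
    det B = complex_of_real (p * (\<Prod>i<n. l i)) \<and>
    det (inv_op_mean h A B) = complex_of_real (p * (\<Prod>i<n. h (l i)))"
    using det_inv_op_mean[OF A B, of h] nonneg by blast
  then have p: "0 < p" and l: "\<And>i. i < n \<Longrightarrow> 0 < l i" and d: "det A = complex_of_real p"
    "det B = complex_of_real (p * (\<Prod>i<n. l i))"
    "det (inv_op_mean h A B) = complex_of_real (p * (\<Prod>i<n. h (l i)))"
    by blast+
  have n0: "0 < n" using n by simp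
  have dims: "dim_row A = n" "dim_row B = n" "dim_row (inv_op_mean h A B) = n"
    using psdD(1)[OF A(1)] psdD(1)[OF B(1)] psdD(1)[OF inv_op_mean_psd[OF A(1) B(1), of h]] nonneg by auto
  have rA: "det_root A = root n p" by (simp add: det_root_def dims d)
  have rB: "det_root B = root n p * root n (\<Prod>i<n. l i)"
    unfolding det_root_def dims d Re_complex_of_real by (rule real_root_mult)
  have rM: "det_root (inv_op_mean h A B) = root n p * root n (\<Prod>i<n. h (l i))"
    unfolding det_root_def dims d Re_complex_of_real by (rule real_root_mult)
  have pr: "0 < root n p" "0 < root n (\<Prod>i<n. l i)"
    using p l n0 by (auto intro!: real_root_gt_zero prod_pos)
  then show "0 < det_root A" "0 < det_root B" by (simp_all add: rA rB)
  have F: "perspective h (det_root A) (det_root B) = root n p * h (root n (\<Prod>i<n. l i))"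
    using pr by (simp add: perspective_def rA rB)
  note jensen = geometric_jensen[OF representing_function_pos[OF h] n l]
  show "perspective h (det_root A) (det_root B) \<le> det_root (inv_op_mean h A B)"
    if "geometrically_convex_on {0..} h"
    unfolding F rM using pr jensen(1)[OF _ _ that] by simp
  show "det_root (inv_op_mean h A B) \<le> perspective h (det_root A) (det_root B)"
    if "geometrically_concave_on {0..} h"
    unfolding F rM using pr jensen(2)[OF _ _ that] by simp
qed

section \<open>Passage to singular matrices\<close>

lemma tendsto_det:
  fixes M :: "'a \<Rightarrow> complex mat"
  assumes M: "\<forall>\<^sub>F t in F. M t \<in> carrier_mat n n" and L: "L \<in> carrier_mat n n"
    and lim: "\<And>i j. i < n \<Longrightarrow> j < n \<Longrightarrow> ((\<lambda>t. M t $$ (i, j)) \<longlongrightarrow> L $$ (i, j)) F"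
  shows "((\<lambda>t. det (M t)) \<longlongrightarrow> det L) F"
proof -
  have "((\<lambda>t. \<Sum>p \<in> {p. p permutes {0..<n}}. signof p * (\<Prod>i = 0..<n. M t $$ (i, p i))) \<longlongrightarrow>
      (\<Sum>p \<in> {p. p permutes {0..<n}}. signof p * (\<Prod>i = 0..<n. L $$ (i, p i)))) F"
    by (intro tendsto_sum tendsto_mult tendsto_const tendsto_prod lim) (use permutes_in_image in fastforce)+
  moreover have "\<forall>\<^sub>F t in F. (\<Sum>p \<in> {p. p permutes {0..<n}}. signof p * (\<Prod>i = 0..<n. M t $$ (i, p i))) = det (M t)"
    using M by (rule eventually_mono) (simp add: det_def')
  ultimately show ?thesis
    unfolding det_def'[OF L] by (rule Lim_transform_eventually)
qed

lemma tendsto_det_root: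
  fixes M :: "'a \<Rightarrow> complex mat"
  assumes M: "\<forall>\<^sub>F t in F. M t \<in> carrier_mat n n" and L: "L \<in> carrier_mat n n"
    and lim: "\<And>i j. i < n \<Longrightarrow> j < n \<Longrightarrow> ((\<lambda>t. M t $$ (i, j)) \<longlongrightarrow> L $$ (i, j)) F"
  shows "((\<lambda>t. det_root (M t)) \<longlongrightarrow> det_root L) F"
proof -
  have "((\<lambda>t. root n (Re (det (M t)))) \<longlongrightarrow> root n (Re (det L))) F"
    by (intro tendsto_real_root tendsto_Re tendsto_det[OF assms])
  moreover have "\<forall>\<^sub>F t in F. root n (Re (det (M t))) = det_root (M t)"
    using M by (rule eventually_mono) (simp add: det_root_def)
  ultimately show ?thesis
    using L by (simp add: det_root_def Lim_transform_eventually)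
qed

lemma tendsto_shift:
  fixes A :: "complex mat"
  assumes "A \<in> carrier_mat n n" "i < n" "j < n"
  shows "((\<lambda>e. (A + complex_of_real e \<cdot>\<^sub>m 1\<^sub>m n) $$ (i, j)) \<longlongrightarrow> A $$ (i, j)) (at_right 0)"
proof -
  have "((\<lambda>e. A $$ (i, j) + complex_of_real e * 1\<^sub>m n $$ (i, j)) \<longlongrightarrow>
      A $$ (i, j) + complex_of_real 0 * 1\<^sub>m n $$ (i, j)) (at_right 0)"
    by (intro tendsto_intros)
  then show ?thesis using assms by simp
qed

text \<open>A value of \<open>Lim\<close> carries information only if the limit exists. Here it does, because the means of the
shifted matrices decrease in the Loewner order as \<open>\<epsilon>\<close> decreases and are bounded below by \<open>0\<close>.\<close>

theorem op_mean_singular_limit: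
  assumes h: "representing_function h" and A: "A \<in> psd_mats n" and B: "B \<in> psd_mats n"
    and sing: "\<not> (invertible_mat A \<and> invertible_mat B)" and ij: "i < n" "j < n"
  shows "((\<lambda>e. inv_op_mean h (A + complex_of_real e \<cdot>\<^sub>m 1\<^sub>m n) (B + complex_of_real e \<cdot>\<^sub>m 1\<^sub>m n) $$ (i, j))
    \<longlongrightarrow> op_mean h A B $$ (i, j)) (at_right 0)"
    (is "((\<lambda>e. ?M e $$ (i, j)) \<longlongrightarrow> _) _")
proof -
  have nonneg: "\<And>x. 0 \<le> x \<Longrightarrow> 0 \<le> h x" and mono: "operator_monotone h"
    using h by (auto simp: representing_function_def)
  have n: "dim_row A = n" using psdD(1)[OF A] by simp
  obtain l where l: "((\<lambda>e. ?M e $$ (i, j)) \<longlongrightarrow> l) (at_right 0)"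
  proof -
    have "\<exists>l. ((\<lambda>e. ?M e $$ (i, j)) \<longlongrightarrow> l) (at_right 0)"
    proof (rule mono_psd_limit[of ?M n, OF _ _ ij])
      show "?M e \<in> psd_mats n" if "0 < e" for e
        using that nonneg by (intro inv_op_mean_psd shift_psd(1) A B) auto
      show "qform (?M e) v \<le> qform (?M \<delta>) v" if "0 < e" "e \<le> \<delta>" "v \<in> carrier_vec n" for e \<delta> v
        using inv_op_mean_shift_mono[OF mono nonneg A B that] .
    qed
    then show ?thesis using that by blast
  qed
  moreover have "op_mean h A B $$ (i, j) = Lim (at_right 0) (\<lambda>e. ?M e $$ (i, j))"
    unfolding op_mean_def if_not_P[OF sing] Let_def n using ij by simp
  ultimately show ?thesis using tendsto_Lim[OF _ l] by simp
qed

lemma inv_op_mean_scalar: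
  assumes "0 < a" "0 < b"
  shows "inv_op_mean h (real_diag 1 (\<lambda>_. a)) (real_diag 1 (\<lambda>_. b)) = real_diag 1 (\<lambda>_. perspective h a b)"
proof -
  have 1: "1 / sqrt a * b * (1 / sqrt a) = b / a" using assms by simp
  have 2: "sqrt a * h (b / a) * sqrt a = perspective h a b"
  proof -
    have "sqrt a * q * sqrt a = (sqrt a * sqrt a) * q" for q by (simp only: mult_ac)
    then show ?thesis using assms by (simp add: perspective_def)
  qed
  show ?thesis
    unfolding inv_op_mean_def Let_def mat_fun_real_diag mat_diag_diag of_real_mult[symmetric] 1 2 ..
qed

text \<open>A uniform description covering the direct definition for positive arguments and the limit that defines
the mean if an argument is zero. It makes the scalar side accessible to \<open>perspective_tendsto\<close>.\<close>

lemma scalar_mean_eq: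
  assumes h: "representing_function h" and ab: "0 \<le> a" "0 \<le> b"
  shows "scalar_mean h a b = (INF (x, y) \<in> {a<..} \<times> {b<..}. perspective h x y)"
proof -
  have m: "mat 1 1 (\<lambda>_. complex_of_real x) = real_diag 1 (\<lambda>_. x)" for x
    by (intro eq_matI) (auto simp: mat_diag_def)
  have inv: "invertible_mat (real_diag 1 (\<lambda>_. x)) \<longleftrightarrow> x \<noteq> 0" for x
    unfolding invertible_iff_det[OF real_diag_carrier] det_real_diag by simp
  show ?thesis
  proof (cases "0 < a \<and> 0 < b")
    case True
    then have "invertible_mat (real_diag 1 (\<lambda>_. a)) \<and> invertible_mat (real_diag 1 (\<lambda>_. b))"
      unfolding inv by simp
    then have "op_mean h (real_diag 1 (\<lambda>_. a)) (real_diag 1 (\<lambda>_. b)) = real_diag 1 (\<lambda>_. perspective h a b)"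
      using True inv_op_mean_scalar[of a b h] unfolding op_mean_def by (metis (no_types))
    then have "scalar_mean h a b = perspective h a b"
      unfolding scalar_mean_def m by (simp add: mat_diag_def)
    moreover have "((\<lambda>_::nat. perspective h a b) \<longlongrightarrow> (INF (x, y) \<in> {a<..} \<times> {b<..}. perspective h x y)) sequentially"
      using True by (intro perspective_tendsto[OF h ab]) auto
    ultimately show ?thesis using LIMSEQ_unique tendsto_const by metis
  next
    case False
    let ?A = "real_diag 1 (\<lambda>_. a)" and ?B = "real_diag 1 (\<lambda>_. b)"
    have "((\<lambda>e. inv_op_mean h (?A + complex_of_real e \<cdot>\<^sub>m 1\<^sub>m 1) (?B + complex_of_real e \<cdot>\<^sub>m 1\<^sub>m 1) $$ (0, 0))
      \<longlongrightarrow> op_mean h ?A ?B $$ (0, 0)) (at_right 0)"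
    proof (rule op_mean_singular_limit[OF h])
      show "\<not> (invertible_mat ?A \<and> invertible_mat ?B)" unfolding inv using False ab by auto
      show "?A \<in> psd_mats 1" "?B \<in> psd_mats 1" using ab by (auto intro: real_diag_psd simp del: One_nat_def)
    qed simp_all
    then have "((\<lambda>e. Re (inv_op_mean h (?A + complex_of_real e \<cdot>\<^sub>m 1\<^sub>m 1) (?B + complex_of_real e \<cdot>\<^sub>m 1\<^sub>m 1) $$ (0, 0)))
      \<longlongrightarrow> scalar_mean h a b) (at_right 0)"
      unfolding scalar_mean_def m by (rule tendsto_Re)
    moreover have "\<forall>\<^sub>F e in at_right 0. Re (inv_op_mean h (?A + complex_of_real e \<cdot>\<^sub>m 1\<^sub>m 1) (?B + complex_of_real e \<cdot>\<^sub>m 1\<^sub>m 1) $$ (0, 0))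
       = perspective h (a + e) (b + e)"
    proof (rule eventually_mono[OF eventually_at_right_less])
      fix e :: real assume e: "0 < e"
      have s: "real_diag 1 (\<lambda>_. x) + complex_of_real e \<cdot>\<^sub>m 1\<^sub>m 1 = real_diag 1 (\<lambda>_. x + e)" for x
        by (intro eq_matI) (auto simp: mat_diag_def)
      have "inv_op_mean h (real_diag 1 (\<lambda>_. a + e)) (real_diag 1 (\<lambda>_. b + e)) = real_diag 1 (\<lambda>_. perspective h (a + e) (b + e))"
        using e ab by (intro inv_op_mean_scalar) auto
      then show "Re (inv_op_mean h (?A + complex_of_real e \<cdot>\<^sub>m 1\<^sub>m 1) (?B + complex_of_real e \<cdot>\<^sub>m 1\<^sub>m 1) $$ (0, 0))
       = perspective h (a + e) (b + e)"
        unfolding s by (simp add: mat_diag_def)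
    qed
    ultimately have "((\<lambda>e. perspective h (a + e) (b + e)) \<longlongrightarrow> scalar_mean h a b) (at_right 0)"
      by (rule Lim_transform_eventually)
    moreover have "((\<lambda>e. perspective h (a + e) (b + e)) \<longlongrightarrow> (INF (x, y) \<in> {a<..} \<times> {b<..}. perspective h x y)) (at_right 0)"
    proof (intro perspective_tendsto[OF h ab])
      have "((\<lambda>e. x + e) \<longlongrightarrow> x + 0) (at_right 0)" for x :: real
        by (intro tendsto_intros)
      then show "((\<lambda>e. a + e) \<longlongrightarrow> a) (at_right 0)" "((\<lambda>e. b + e) \<longlongrightarrow> b) (at_right 0)"
        by simp_all
      show "\<forall>\<^sub>F e in at_right 0. 0 < a + e" "\<forall>\<^sub>F e in at_right 0. 0 < b + e"
        using ab by (auto intro!: eventually_mono[OF eventually_at_right_less])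
    qed
    ultimately show ?thesis using tendsto_unique[of "at_right (0::real)"] by simp
  qed
qed

lemma det_root_nonneg: "A \<in> psd_mats n \<Longrightarrow> 0 \<le> det_root A"
  using psd_det_nonneg[of A n] by (simp add: det_root_def real_root_ge_zero)

text \<open>Lets the final argument treat both clauses in the definition of the mean alike: invertible matrices
approximate themselves, and otherwise the shifts \<open>A + \<epsilon> I\<close> and \<open>B + \<epsilon> I\<close> serve.\<close>

lemma op_mean_invertible_approximation:
  assumes h: "representing_function h" and A: "A \<in> psd_mats n" and B: "B \<in> psd_mats n"
  shows "\<exists>P Q. (\<forall>e>0. P e \<in> psd_mats n \<and> det (P e) \<noteq> 0 \<and> Q e \<in> psd_mats n \<and> det (Q e) \<noteq> 0) \<and>
    ((\<lambda>e. det_root (P e)) \<longlongrightarrow> det_root A) (at_right (0::real)) \<and>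
    ((\<lambda>e. det_root (Q e)) \<longlongrightarrow> det_root B) (at_right 0) \<and>
    ((\<lambda>e. det_root (inv_op_mean h (P e) (Q e))) \<longlongrightarrow> det_root (op_mean h A B)) (at_right 0)"
proof (cases "invertible_mat A \<and> invertible_mat B")
  case True
  then show ?thesis
    using A B invertible_iff_det[OF psdD(1)[OF A]] invertible_iff_det[OF psdD(1)[OF B]]
    by (intro exI[of _ "\<lambda>_. A"] exI[of _ "\<lambda>_. B"]) (simp add: op_mean_def)
next
  case False
  have nonneg: "\<And>x. 0 \<le> x \<Longrightarrow> 0 \<le> h x"
    using h by (auto simp: representing_function_def)
  let ?P = "\<lambda>e. A + complex_of_real e \<cdot>\<^sub>m 1\<^sub>m n" and ?Q = "\<lambda>e. B + complex_of_real e \<cdot>\<^sub>m 1\<^sub>m n"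
  have PQ: "?P e \<in> psd_mats n \<and> det (?P e) \<noteq> 0 \<and> ?Q e \<in> psd_mats n \<and> det (?Q e) \<noteq> 0" if "0 < e" for e
    using that shift_psd(1)[OF A] shift_psd(1)[OF B] det_shift_pos[OF A] det_shift_pos[OF B] by auto
  have lim: "((\<lambda>e. det_root (X + complex_of_real e \<cdot>\<^sub>m 1\<^sub>m n)) \<longlongrightarrow> det_root X) (at_right 0)"
    if "X \<in> carrier_mat n n" for X
    using that by (intro tendsto_det_root tendsto_shift) auto
  have "op_mean h A B \<in> carrier_mat n n"
    using False psdD(1)[OF A] by (auto simp: op_mean_def Let_def)
  moreover have "\<forall>\<^sub>F e in at_right 0. inv_op_mean h (?P e) (?Q e) \<in> carrier_mat n n"
    using eventually_at_right_less[of 0] by (rule eventually_mono) (use PQ nonneg psdD(1) inv_op_mean_psd in blast)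
  ultimately have "((\<lambda>e. det_root (inv_op_mean h (?P e) (?Q e))) \<longlongrightarrow> det_root (op_mean h A B)) (at_right 0)"
    by (intro tendsto_det_root op_mean_singular_limit[OF h A B False])
  then show ?thesis
    using PQ lim[OF psdD(1)[OF A]] lim[OF psdD(1)[OF B]]
    by (intro exI[of _ ?P] exI[of _ ?Q] conjI allI impI) auto
qed

text \<open>The inequality for the invertible approximants passes to the limit on both sides.\<close>

theorem corollary3p2:
  fixes h :: "real \<Rightarrow> real" and n :: nat
  assumes "representing_function h" and "n \<ge> 1"
  shows "(geometrically_convex_on {0..} h \<longrightarrow>
            (\<forall>A \<in> psd_mats n. \<forall>B \<in> psd_mats n.
               det_root (op_mean h A B) \<ge> scalar_mean h (det_root A) (det_root B))) \<and>
         (geometrically_concave_on {0..} h \<longrightarrow>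
            (\<forall>A \<in> psd_mats n. \<forall>B \<in> psd_mats n.
               det_root (op_mean h A B) \<le> scalar_mean h (det_root A) (det_root B)))"
proof (intro conjI impI ballI)
  fix A B assume A: "A \<in> psd_mats n" and B: "B \<in> psd_mats n"
  obtain P Q where PQ: "\<And>e. 0 < e \<Longrightarrow> P e \<in> psd_mats n \<and> det (P e) \<noteq> 0 \<and> Q e \<in> psd_mats n \<and> det (Q e) \<noteq> 0"
    and P: "((\<lambda>e. det_root (P e)) \<longlongrightarrow> det_root A) (at_right (0::real))"
    and Q: "((\<lambda>e. det_root (Q e)) \<longlongrightarrow> det_root B) (at_right 0)"
    and M: "((\<lambda>e. det_root (inv_op_mean h (P e) (Q e))) \<longlongrightarrow> det_root (op_mean h A B)) (at_right 0)"
    using op_mean_invertible_approximation[OF assms(1) A B] by blast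
  note core = det_root_inv_op_mean[OF assms]
  have ev: "\<forall>\<^sub>F e in at_right 0. \<Phi> e" if "\<And>e. 0 < e \<Longrightarrow> \<Phi> e" for \<Phi> :: "real \<Rightarrow> bool"
    using that by (auto intro: eventually_mono[OF eventually_at_right_less])
  have S: "((\<lambda>e. perspective h (det_root (P e)) (det_root (Q e))) \<longlongrightarrow> scalar_mean h (det_root A) (det_root B)) (at_right 0)"
    unfolding scalar_mean_eq[OF assms(1) det_root_nonneg[OF A] det_root_nonneg[OF B]]
    using P Q PQ by (intro perspective_tendsto[OF assms(1)] det_root_nonneg[OF A] det_root_nonneg[OF B] ev core(1,2)) auto
  show "scalar_mean h (det_root A) (det_root B) \<le> det_root (op_mean h A B)"
    if "geometrically_convex_on {0..} h"
    using PQ that by (intro tendsto_le[OF _ M S] ev core(3)) auto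
  show "det_root (op_mean h A B) \<le> scalar_mean h (det_root A) (det_root B)"
    if "geometrically_concave_on {0..} h"
    using PQ that by (intro tendsto_le[OF _ S M] ev core(4)) auto
qed

end
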